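(* Let $N\ge3$ be an integer, $p\ge q\ge1$ and $pq>1$. If $q<\frac{N+p}{(N-1)p}$, there is no positive supersolution $(u_1,u_2)$ of the system $$-\Delta u_1=|\nabla u_2|^p,\qquad -\Delta u_2=|\nabla u_1|^q$$ in an exterior set $\mathbb{R}^N\setminus\overline{B_{r_0}}$ ($r_0>0$) such that $\lim_{r\to\infty}\overline{u_1}(r)=0$.
   Context: A supersolution in a domain $\Omega$ is a couple of $C^2(\Omega)$ functions with $-\Delta u_1\ge|\nabla u_2|^p$ and $-\Delta u_2\ge|\nabla u_1|^q$ in $\Omega$. $\overline{u}(r)$ denotes the mean value of $u$ on the sphere $\{|x|=r\}$. $B_{r_0}$ is the ball with center $0$ and radius $r_0$. *)

theory Defs
  imports "HOL-Analysis.Analysis"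
begin

definition partial_deriv :: "'a::euclidean_space \<Rightarrow> ('a \<Rightarrow> real) \<Rightarrow> 'a \<Rightarrow> real"
  where "partial_deriv b f x = frechet_derivative f (at x) b"

definition C1_on :: "'a::euclidean_space set \<Rightarrow> ('a \<Rightarrow> real) \<Rightarrow> bool"
  where "C1_on S f \<longleftrightarrow>
    (\<forall>x\<in>S. f differentiable (at x)) \<and> (\<forall>b\<in>Basis. continuous_on S (partial_deriv b f))"

(* Intended for open S only: derivatives are taken in the full space. *)
definition C2_on :: "'a::euclidean_space set \<Rightarrow> ('a \<Rightarrow> real) \<Rightarrow> bool"
  where "C2_on S f \<longleftrightarrow> C1_on S f \<and> (\<forall>b\<in>Basis. C1_on S (partial_deriv b f))"

definition gradient :: "('a::euclidean_space \<Rightarrow> real) \<Rightarrow> 'a \<Rightarrow> 'a"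
  where "gradient f x = (\<Sum>b\<in>Basis. partial_deriv b f x *\<^sub>R b)"

definition laplacian :: "('a::euclidean_space \<Rightarrow> real) \<Rightarrow> 'a \<Rightarrow> real"
  where "laplacian f x = (\<Sum>b\<in>Basis. partial_deriv b (partial_deriv b f) x)"

definition supersolution ::
    "'a::euclidean_space set \<Rightarrow> real \<Rightarrow> real \<Rightarrow> ('a \<Rightarrow> real) \<Rightarrow> ('a \<Rightarrow> real) \<Rightarrow> bool"
  where "supersolution \<Omega> p q u\<^sub>1 u\<^sub>2 \<longleftrightarrow>
    C2_on \<Omega> u\<^sub>1 \<and> C2_on \<Omega> u\<^sub>2 \<and>
    (\<forall>x\<in>\<Omega>. - laplacian u\<^sub>1 x \<ge> norm (gradient u\<^sub>2 x) powr p \<and>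
            - laplacian u\<^sub>2 x \<ge> norm (gradient u\<^sub>1 x) powr q)"

(* The surface measure of the unit sphere, in its cone (polar coordinates) form: the measure of a
   Borel set A of the sphere is N times the volume of the part of the unit ball lying over A, that
   is, of the points x with 0 < |x| < 1 and x / |x| in A.  Note that sgn x = x /\<^sub>R norm x.
   The space of the measure is the sphere itself, so that integrals do not depend on
   values off the sphere (where an integrand may fail to be measurable). *)
definition unit_sphere_measure :: "'a::euclidean_space measure"
  where "unit_sphere_measure =
    scale_measure (of_nat DIM('a))
      (distr (restrict_space lborel (ball 0 1 - {0})) (restrict_space borel (sphere 0 1)) sgn)"

(* The mean over the sphere of radius r, pulled back to the unit sphere by y = r x. *)
definition spherical_mean :: "('a::euclidean_space \<Rightarrow> real) \<Rightarrow> real \<Rightarrow> real"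
  where "spherical_mean u r =
    (\<integral>x. u (r *\<^sub>R x) \<partial>unit_sphere_measure) / measure (unit_sphere_measure :: 'a measure) (sphere 0 1)"

lemma emeasure_unit_sphere_measure:
  fixes A :: "'a::euclidean_space set"
  assumes "A \<in> sets borel" "A \<subseteq> sphere 0 1"
  shows "emeasure unit_sphere_measure A =
    of_nat DIM('a) * emeasure lborel {x \<in> ball 0 1 - {0}. sgn x \<in> A}"
proof -
  have "(sgn :: 'a \<Rightarrow> 'a) \<in> restrict_space lborel (ball 0 1 - {0}) \<rightarrow>\<^sub>M borel"
    by (rule measurable_restrict_space1) (simp add: sgn_div_norm)
  then have m: "(sgn :: 'a \<Rightarrow> 'a) \<in>
      restrict_space lborel (ball 0 1 - {0}) \<rightarrow>\<^sub>M restrict_space borel (sphere 0 1)"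
    by (rule measurable_restrict_space2[rotated]) (auto simp: space_restrict_space norm_sgn)
  have A: "A \<in> sets (restrict_space borel (sphere 0 1))"
    using assms by (simp add: sets_restrict_space_iff)
  have "{x \<in> ball (0::'a) 1 - {0}. sgn x \<in> A} = sgn -` A \<inter> (ball 0 1 - {0})"
    by auto
  then show ?thesis
    using A m
    by (simp add: unit_sphere_measure_def emeasure_distr space_restrict_space emeasure_restrict_space)
qed

lemma measure_unit_sphere:
  "measure (unit_sphere_measure :: 'a::euclidean_space measure) (sphere 0 1) =
    DIM('a) * unit_ball_vol DIM('a)"
proof -
  have eq: "{x \<in> ball (0::'a) 1 - {0}. sgn x \<in> sphere 0 1} = ball 0 1 - {0}"
    by (auto simp: norm_sgn)
  have "emeasure lborel (ball (0::'a) 1 - {0}) = ennreal (unit_ball_vol DIM('a))"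
    by (simp add: emeasure_Diff emeasure_ball)
  then have "emeasure (unit_sphere_measure :: 'a measure) (sphere 0 1) =
      of_nat DIM('a) * ennreal (unit_ball_vol DIM('a))"
    by (subst emeasure_unit_sphere_measure, simp, simp, subst eq, simp)
  then show ?thesis
    by (simp add: measure_def enn2real_mult)
qed

lemma integrable_unit_sphere_measure:
  fixes f :: "'a::euclidean_space \<Rightarrow> real"
  assumes "continuous_on (sphere 0 1) f"
  shows "integrable unit_sphere_measure f"
proof -
  have sp: "space (unit_sphere_measure :: 'a measure) = sphere 0 1"
    by (simp add: unit_sphere_measure_def space_scale_measure space_restrict_space)
  have se: "sets (unit_sphere_measure :: 'a measure) = sets (restrict_space borel (sphere 0 1))"
    by (simp add: unit_sphere_measure_def)
  have "measure (unit_sphere_measure :: 'a measure) (sphere 0 1) > 0"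
    by (simp add: measure_unit_sphere)
  then have "emeasure (unit_sphere_measure :: 'a measure) (sphere 0 1) \<noteq> \<infinity>"
    by (auto simp: measure_def)
  then interpret finite_measure "unit_sphere_measure :: 'a measure"
    by (intro finite_measureI) (simp add: sp)
  have m: "f \<in> borel_measurable unit_sphere_measure"
    using borel_measurable_continuous_on_restrict[OF assms] measurable_cong_sets[OF se refl]
    by blast
  have "bounded (f ` sphere 0 1)"
    using assms compact_continuous_image compact_imp_bounded compact_sphere by blast
  then obtain B where "\<And>x. x \<in> sphere 0 1 \<Longrightarrow> norm (f x) \<le> B"
    unfolding bounded_iff by blast
  then show ?thesis
    using m by (intro integrable_const_bound[of _ B]) (auto simp: sp intro!: AE_I2)
qed

end

theory Submission imports Defs begin

text \<open>
Replace the two functions by their spherical means.  If \<open>v\<^sub>1, v\<^sub>2\<close> are the means of a supersolution in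
\<open>N\<close> dimensions, then Jensen's inequality (the exponents are at least one) and
\<open>\<bar>\<nabla>u \<cdot> x\<bar> \<le> norm (\<nabla>u)\<close> on the unit sphere give for the inward fluxes \<open>w\<^sub>i = - r\<^sup>N\<^sup>-\<^sup>1 v\<^sub>i'\<close>

  \<open>w\<^sub>1' \<ge> r\<^sup>N\<^sup>-\<^sup>1 \<bar>v\<^sub>2'\<bar>\<^sup>p\<close> and \<open>w\<^sub>2' \<ge> r\<^sup>N\<^sup>-\<^sup>1 \<bar>v\<^sub>1'\<bar>\<^sup>q\<close>.

Both fluxes are nondecreasing.  Since \<open>v\<^sub>1\<close> is positive and tends to zero, \<open>w\<^sub>1\<close> is eventually bounded
below by a positive constant.  As \<open>q < N / (N - 1)\<close>, integrating the second inequality makes \<open>w\<^sub>2\<close>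
grow like a positive power of \<open>r\<close>; by the condition on \<open>q\<close>, integrating the first one then makes
\<open>w\<^sub>1\<close> grow like \<open>r\<^sup>\<delta>\<close> with \<open>\<delta> = N + p - p q (N - 1) > 0\<close>.  Each repetition raises the exponent by at
least \<open>\<delta>\<close>, so eventually \<open>w\<^sub>1\<close> exceeds a multiple of \<open>r\<^sup>N\<^sup>-\<^sup>1\<close>, and then \<open>v\<^sub>1\<close> decreases at least
linearly and becomes negative (lemma \<open>radial_system_impossible\<close>).

The analytic input is that the flux of \<open>\<nabla>u\<close> through spheres has the surface integral of the Laplacian
as derivative (lemma \<open>DERIV_flux\<close>).  It rests on a divergence theorem for the unit sphere
(\<open>sphere_divergence\<close>), which is obtained for a field \<open>F\<close> on the sphere by integrating the divergence
of \<open>F (sgn x)\<close>, cut off to a shell, over the whole space.  The only facts used for this are the translation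
invariance of Lebesgue measure (\<open>integral_directional_derivative_eq_0\<close>) and its homogeneity under
dilations, which separates radial from spherical integrals (\<open>integral_polar_separation\<close>).\<close>


section \<open>Separation of radial and spherical integrals\<close>

lemma space_unit_sphere_measure: "space (unit_sphere_measure :: 'a::euclidean_space measure) = sphere 0 1"
  by (simp add: unit_sphere_measure_def space_scale_measure space_restrict_space)

lemma measurable_sgn_euclidean [measurable]: "(sgn :: 'a::euclidean_space \<Rightarrow> 'a) \<in> borel_measurable borel"
  by (simp add: sgn_div_norm)

lemma emeasure_unit_sphere:
  "emeasure (unit_sphere_measure :: 'a::euclidean_space measure) (sphere 0 1)
     = ennreal (DIM('a) * unit_ball_vol DIM('a))"
proof -
  have "measure (unit_sphere_measure :: 'a measure) (sphere 0 1) > 0"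
    by (simp add: measure_unit_sphere)
  then have "emeasure (unit_sphere_measure :: 'a measure) (sphere 0 1) \<noteq> \<infinity>"
    by (auto simp: measure_def)
  then show ?thesis
    using emeasure_eq_ennreal_measure[of unit_sphere_measure "sphere (0::'a) 1"] 
    by (simp add: measure_unit_sphere top.not_eq_extremum)
qed

lemma finite_unit_sphere_measure: "finite_measure (unit_sphere_measure :: 'a::euclidean_space measure)"
  by (rule finite_measureI) (simp add: space_unit_sphere_measure emeasure_unit_sphere)

lemma nn_integral_unit_sphere_measure:
  fixes g :: "'a::euclidean_space \<Rightarrow> ennreal"
  assumes [measurable]: "g \<in> borel_measurable borel"
  shows "(\<integral>\<^sup>+ x. g x \<partial>unit_sphere_measure) =
    of_nat DIM('a) * (\<integral>\<^sup>+ x. g (sgn x) * indicator (ball 0 1) x \<partial>lborel)"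
proof -
  have "(sgn :: 'a \<Rightarrow> 'a) \<in> restrict_space lborel (ball 0 1 - {0}) \<rightarrow>\<^sub>M borel"
    by (rule measurable_restrict_space1) (simp add: sgn_div_norm)
  then have m: "(sgn :: 'a \<Rightarrow> 'a) \<in>
      restrict_space lborel (ball 0 1 - {0}) \<rightarrow>\<^sub>M restrict_space borel (sphere 0 1)"
    by (rule measurable_restrict_space2[rotated]) (auto simp: space_restrict_space norm_sgn)
  have g: "g \<in> borel_measurable (restrict_space borel (sphere 0 1))"
    by (rule measurable_restrict_space1) simp
  have "(\<integral>\<^sup>+ x. g x \<partial>unit_sphere_measure) = of_nat DIM('a) *
      (\<integral>\<^sup>+ x. g (sgn x) * indicator (ball 0 1 - {0}) x \<partial>lborel)"
    unfolding unit_sphere_measure_def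
    by (simp add: nn_integral_scale_measure g nn_integral_distr[OF m] nn_integral_restrict_space)
  also have "(\<integral>\<^sup>+ x. g (sgn x) * indicator (ball 0 1 - {0}) x \<partial>lborel)
      = (\<integral>\<^sup>+ x. g (sgn x) * indicator (ball 0 1) x \<partial>lborel)"
    by (rule nn_integral_cong_AE)
       (use AE_lborel_singleton[of "0::'a"] in eventually_elim, auto split: split_indicator)
  finally show ?thesis .
qed

text \<open>The integrand is constant along rays, so the dilation by \<open>R\<close> changes only the volume element.\<close>

lemma nn_integral_cone_scaling:
  fixes g :: "'a::euclidean_space \<Rightarrow> ennreal"
  assumes [measurable]: "g \<in> borel_measurable borel" and R: "0 < R"
  shows "(\<integral>\<^sup>+ x. g (sgn x) * indicator (ball 0 R) x \<partial>lborel) =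
     ennreal (R ^ DIM('a)) * (\<integral>\<^sup>+ x. g (sgn x) * indicator (ball 0 1) x \<partial>lborel)"
proof -
  have s: "sgn (R *\<^sub>R x) = sgn x" for x :: 'a
    using R by (simp add: sgn_scaleR)
  have i: "indicator (ball 0 R) (R *\<^sub>R x) = (indicator (ball 0 1) x :: ennreal)" for x :: 'a
    using R by (auto simp: indicator_def)
  have k: "(\<lambda>x. g (sgn x) * indicator (ball 0 r) x) \<in> borel_measurable borel" for r
    using measurable_compose[OF measurable_sgn_euclidean assms(1)]
    by (intro borel_measurable_times_ennreal borel_measurable_indicator) auto
  have "(\<integral>\<^sup>+ x. g (sgn x) * indicator (ball 0 R) x \<partial>lborel)
    = (\<integral>\<^sup>+ x. g (sgn x) * indicator (ball 0 R) x \<partial>density (distr lborel borel (\<lambda>x::'a. 0 + R *\<^sub>R x)) (\<lambda>_. ennreal (\<bar>R\<bar> ^ DIM('a))))"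
    using R lborel_affine[of R "0::'a"] by simp
  also have "\<dots> = (\<integral>\<^sup>+ x. ennreal (R ^ DIM('a)) * (g (sgn x) * indicator (ball 0 1) x) \<partial>lborel)"
    using k R by (simp add: nn_integral_density nn_integral_distr s i)
  finally show ?thesis
    using k[of 1] by (simp add: nn_integral_cmult)
qed

text \<open>The part of polar coordinates that the proof needs: a function of \<open>norm x\<close> times a function of
\<open>sgn x\<close> integrates to a product of a radial and a spherical factor.  Normalising by the integral
of the radial factor over the whole space, instead of a weight \<open>s\<^sup>N\<^sup>-\<^sup>1 ds\<close>, avoids disintegrating
Lebesgue measure.  By scaling, the image of \<open>g (sgn x) dx\<close> under the norm gives to a ball of radius
\<open>R\<close> the mass \<open>R\<^sup>N\<close> times a constant, so for different \<open>g\<close> these measures on the half line are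
proportional.\<close>

lemma nn_integral_polar_separation:
  fixes g :: "'a::euclidean_space \<Rightarrow> ennreal"
  assumes [measurable]: "g \<in> borel_measurable borel" "h \<in> borel_measurable borel"
    and fin: "(\<integral>\<^sup>+ x. g x \<partial>unit_sphere_measure) < \<infinity>"
  shows "emeasure unit_sphere_measure (sphere (0::'a) 1) * (\<integral>\<^sup>+ x. h (norm x) * g (sgn x) \<partial>lborel)
     = (\<integral>\<^sup>+ x. g x \<partial>unit_sphere_measure) * (\<integral>\<^sup>+ x. h (norm (x::'a)) \<partial>lborel)"
proof -
  \<comment> \<open>The minus sign turns balls into the half lines \<open>{a<..}\<close>, which have finite mass and
    determine the measure.\<close>
  define \<nu> :: "('a \<Rightarrow> ennreal) \<Rightarrow> real measure"
    where "\<nu> f = distr (density lborel (\<lambda>x. f (sgn x))) borel (\<lambda>x. - norm x)" for f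
  define S where "S f = (\<integral>\<^sup>+ x. f x \<partial>unit_sphere_measure)" for f :: "'a \<Rightarrow> ennreal"
  define one where "one = (\<lambda>x::'a. 1::ennreal)"
  have N: "of_nat DIM('a) \<noteq> (0::ennreal)" "of_nat DIM('a) \<noteq> (top::ennreal)"
    by auto
  have em: "of_nat DIM('a) * emeasure (\<nu> f) {a<..} = (if a < 0 then ennreal ((-a) ^ DIM('a)) else 0) * S f"
    if [measurable]: "f \<in> borel_measurable borel" for f a
  proof -
    have "emeasure (\<nu> f) {a<..} = emeasure (density lborel (\<lambda>x. f (sgn x))) (ball 0 (-a))"
      unfolding \<nu>_def by (subst emeasure_distr) (auto intro!: arg_cong2[where f=emeasure])
    also have "\<dots> = (\<integral>\<^sup>+ x. f (sgn x) * indicator (ball 0 (-a)) x \<partial>lborel)"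
      by (subst emeasure_density) auto
    finally have 1: "emeasure (\<nu> f) {a<..} = (\<integral>\<^sup>+ x. f (sgn x) * indicator (ball 0 (-a)) x \<partial>lborel)" .
    show ?thesis
    proof (cases "a < 0")
      case True
      then show ?thesis unfolding 1 S_def
        by (subst nn_integral_cone_scaling) (auto simp: nn_integral_unit_sphere_measure mult_ac)
    next
      case False
      then have e: "ball (0::'a) (-a) = {}" by auto
      from False show ?thesis unfolding 1 e by simp
    qed
  qed
  have S1: "S one = emeasure unit_sphere_measure (sphere (0::'a) 1)"
    by (simp add: S_def one_def space_unit_sphere_measure)
  have S1fin: "S one < \<infinity>"
    unfolding S1 by (simp add: emeasure_unit_sphere)
  have onem: "one \<in> borel_measurable borel" by (simp add: one_def)
  have finS: "S g < \<infinity>" using fin by (simp add: S_def)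
  have "scale_measure (S one) (\<nu> g) = scale_measure (S g) (\<nu> one)"
  proof (rule measure_eqI_lessThan)
    show "sets (scale_measure (S one) (\<nu> g)) = sets borel" "sets (scale_measure (S g) (\<nu> one)) = sets borel"
      by (auto simp: \<nu>_def)
    fix x
    have e: "of_nat DIM('a) * emeasure (scale_measure (S one) (\<nu> g)) {x<..} =
        of_nat DIM('a) * emeasure (scale_measure (S g) (\<nu> one)) {x<..}"
      using em[of g x] em[of one x] onem by (simp add: mult.left_commute[of "of_nat _"]) (simp add: mult_ac)
    then show "emeasure (scale_measure (S one) (\<nu> g)) {x<..} = emeasure (scale_measure (S g) (\<nu> one)) {x<..}"
      using N by (simp add: ennreal_mult_cancel_left)
    have "of_nat DIM('a) * emeasure (\<nu> g) {x<..} < \<infinity>"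
      unfolding em[OF assms(1)] using finS by (auto simp: ennreal_mult_less_top)
    then have "emeasure (\<nu> g) {x<..} < \<infinity>"
      using N by (auto simp: ennreal_mult_less_top)
    with S1fin show "emeasure (scale_measure (S one) (\<nu> g)) {x<..} < \<infinity>"
      by (auto simp: ennreal_mult_less_top)
  qed
  then have "(\<integral>\<^sup>+ s. h (-s) \<partial>scale_measure (S one) (\<nu> g)) = (\<integral>\<^sup>+ s. h (-s) \<partial>scale_measure (S g) (\<nu> one))"
    by simp
  moreover have "(\<lambda>s. h (-s)) \<in> borel_measurable borel" by measurable
  then have "(\<integral>\<^sup>+ s. h (-s) \<partial>scale_measure c (\<nu> f)) = c * (\<integral>\<^sup>+ x. f (sgn x) * h (norm x) \<partial>lborel)"
    if [measurable]: "f \<in> borel_measurable borel" for c f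
    by (subst nn_integral_scale_measure) (simp_all add: \<nu>_def nn_integral_distr nn_integral_density)
  ultimately show ?thesis
    using onem by (simp add: S1[symmetric]) (simp add: S_def one_def mult_ac)
qed

lemma integrable_continuous_compact_support:
  fixes f :: "'a::euclidean_space \<Rightarrow> real"
  assumes cont: "continuous_on UNIV f" and supp: "\<And>x. norm x > R \<Longrightarrow> f x = 0"
  shows "integrable lborel f"
proof -
  have "integrable lborel (\<lambda>x. indicator (cball 0 R) x *\<^sub>R f x)"
    by (rule borel_integrable_compact) (auto intro: continuous_on_subset[OF cont])
  also have "(\<lambda>x. indicator (cball 0 R) x *\<^sub>R f x) = f"
    using supp by (force simp: indicator_def not_le)
  finally show ?thesis .
qed

text \<open>The real version follows by splitting both factors into positive and negative parts.  The function
\<open>k\<close> is only known on the sphere; extended by zero it becomes Borel, and this changes the integrand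
at most at the origin, where \<open>sgn\<close> leaves the sphere.\<close>

lemma integral_polar_separation:
  fixes k :: "'a::euclidean_space \<Rightarrow> real" and \<psi> :: "real \<Rightarrow> real"
  assumes k: "continuous_on (sphere 0 1) k"
    and \<psi>: "continuous_on UNIV \<psi>" and supp: "\<And>s. s > b \<Longrightarrow> \<psi> s = 0"
  shows "integrable lborel (\<lambda>x. \<psi> (norm x) * k (sgn x))"
    and "measure unit_sphere_measure (sphere (0::'a) 1) * (\<integral>x. \<psi> (norm x) * k (sgn x) \<partial>lborel)
       = (\<integral>x. k x \<partial>unit_sphere_measure) * (\<integral>x. \<psi> (norm (x::'a)) \<partial>lborel)"
proof -
  let ?\<omega> = "measure unit_sphere_measure (sphere (0::'a) 1)"
  define ext where "ext f x = indicator (sphere 0 1) x *\<^sub>R f x" for f :: "'a \<Rightarrow> real" and x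
  have ext_meas: "ext f \<in> borel_measurable borel" if "continuous_on (sphere 0 1) f" for f
    unfolding ext_def[abs_def] by (rule borel_measurable_continuous_on_indicator[OF _ that]) simp
  have ext_int: "(\<integral>x. ext f x \<partial>unit_sphere_measure) = (\<integral>x. f x \<partial>unit_sphere_measure)" for f
    by (rule Bochner_Integration.integral_cong) (auto simp: ext_def space_unit_sphere_measure)
  have rad_int: "integrable lborel (\<lambda>x::'a. \<phi> (norm x))"
    if "continuous_on UNIV \<phi>" "\<And>s. s > b \<Longrightarrow> \<phi> s = 0" for \<phi> :: "real \<Rightarrow> real"
    using that by (intro integrable_continuous_compact_support[where R=b])
      (auto intro!: continuous_on_compose2[of UNIV \<phi>] continuous_intros)
  have int: "integrable lborel (\<lambda>x. \<phi> (norm x) * ext f (sgn x))"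
    if f: "continuous_on (sphere 0 1) f" and \<phi>: "continuous_on UNIV \<phi>" "\<And>s. s > b \<Longrightarrow> \<phi> s = 0"
    for f :: "'a \<Rightarrow> real" and \<phi> :: "real \<Rightarrow> real"
  proof -
    have "bounded (f ` sphere 0 1)"
      using f compact_continuous_image compact_imp_bounded compact_sphere by blast
    then obtain C where C: "\<forall>x\<in>sphere 0 1. \<bar>f x\<bar> \<le> C"
      by (auto simp: bounded_iff)
    have extC: "\<bar>ext f x\<bar> \<le> max C 0" for x
      using C[rule_format, of x] by (auto simp: ext_def indicator_def max_def)
    show ?thesis
    proof (rule Bochner_Integration.integrable_bound)
      show "integrable lborel (\<lambda>x::'a. max C 0 * \<phi> (norm x))"
        using rad_int[OF \<phi>] by (intro integrable_mult_right) auto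
      have "(\<lambda>x. ext f (sgn x)) \<in> borel_measurable borel"
        by (rule measurable_compose[OF measurable_sgn_euclidean ext_meas[OF f]])
      then show "(\<lambda>x. \<phi> (norm x) * ext f (sgn x)) \<in> borel_measurable lborel"
        using rad_int[OF \<phi>] by (intro borel_measurable_times) auto
      show "AE x in lborel. norm (\<phi> (norm x) * ext f (sgn x)) \<le> norm (max C 0 * \<phi> (norm x))"
      proof (rule AE_I2)
        fix x :: 'a
        show "norm (\<phi> (norm x) * ext f (sgn x)) \<le> norm (max C 0 * \<phi> (norm x))"
          using mult_right_mono[OF extC[of "sgn x"], of "\<bar>\<phi> (norm x)\<bar>"]
          by (simp add: abs_mult mult.commute)
      qed
    qed
  qed
  have nonneg: "?\<omega> * (\<integral>x. \<phi> (norm x) * ext f (sgn x) \<partial>lborel)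
       = (\<integral>x. f x \<partial>unit_sphere_measure) * (\<integral>x. \<phi> (norm (x::'a)) \<partial>lborel)"
    if f: "continuous_on (sphere 0 1) f" "\<And>x. x \<in> sphere 0 1 \<Longrightarrow> 0 \<le> f x"
      and \<phi>: "continuous_on UNIV \<phi>" "\<And>s. s > b \<Longrightarrow> \<phi> s = 0" "\<And>s. 0 \<le> \<phi> s"
    for f :: "'a \<Rightarrow> real" and \<phi> :: "real \<Rightarrow> real"
  proof -
    have e0: "0 \<le> ext f x" for x
      using f(2) by (auto simp: ext_def indicator_def)
    have eint: "integrable unit_sphere_measure (ext f)"
      using integrable_unit_sphere_measure[OF f(1)]
      by (rule Bochner_Integration.integrable_cong[THEN iffD1, rotated -1])
         (auto simp: ext_def space_unit_sphere_measure)
    have m: "(\<lambda>x. ennreal (ext f x)) \<in> borel_measurable borel"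
      using ext_meas[OF f(1)] by simp
    have m\<phi>: "(\<lambda>s. ennreal (\<phi> s)) \<in> borel_measurable borel"
      using borel_measurable_continuous_onI[OF \<phi>(1)] by simp
    have S: "(\<integral>\<^sup>+x. ennreal (ext f x) \<partial>unit_sphere_measure) = ennreal (\<integral>x. f x \<partial>unit_sphere_measure)"
      using nn_integral_eq_integral[OF eint] e0 ext_int[of f] by simp
    have R: "(\<integral>\<^sup>+x. ennreal (\<phi> (norm (x::'a))) \<partial>lborel) = ennreal (\<integral>x. \<phi> (norm (x::'a)) \<partial>lborel)"
      using nn_integral_eq_integral[OF rad_int[OF \<phi>(1,2)]] \<phi>(3) by simp
    have P: "(\<integral>\<^sup>+x. ennreal (\<phi> (norm x)) * ennreal (ext f (sgn x)) \<partial>lborel)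
        = ennreal (\<integral>x. \<phi> (norm x) * ext f (sgn x) \<partial>lborel)"
      using nn_integral_eq_integral[OF int[OF f(1) \<phi>(1,2)]] \<phi>(3) e0 by (simp add: ennreal_mult')
    have W: "emeasure unit_sphere_measure (sphere (0::'a) 1) = ennreal ?\<omega>"
      by (simp add: emeasure_unit_sphere measure_unit_sphere)
    have i0: "0 \<le> (\<integral>x. f x \<partial>unit_sphere_measure)" 
      unfolding ext_int[of f, symmetric] by (intro Bochner_Integration.integral_nonneg e0)
    have "ennreal ?\<omega> * ennreal (\<integral>x. \<phi> (norm x) * ext f (sgn x) \<partial>lborel)
       = ennreal (\<integral>x. f x \<partial>unit_sphere_measure) * ennreal (\<integral>x. \<phi> (norm (x::'a)) \<partial>lborel)"
      using nn_integral_polar_separation[OF m m\<phi>] unfolding S R P W by simp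
    then show ?thesis
      using i0 \<phi>(3) e0 by (simp add: ennreal_mult'[symmetric] Bochner_Integration.integral_nonneg)
  qed
  have half: "?\<omega> * (\<integral>x. \<phi> (norm x) * ext k (sgn x) \<partial>lborel)
       = (\<integral>x. k x \<partial>unit_sphere_measure) * (\<integral>x. \<phi> (norm (x::'a)) \<partial>lborel)"
    if \<phi>: "continuous_on UNIV \<phi>" "\<And>s. s > b \<Longrightarrow> \<phi> s = 0" "\<And>s. 0 \<le> \<phi> s" for \<phi> :: "real \<Rightarrow> real"
  proof -
    have kp: "continuous_on (sphere 0 1) (\<lambda>x. max (k x) 0)" and km: "continuous_on (sphere 0 1) (\<lambda>x. max (- k x) 0)"
      using k by (auto intro!: continuous_intros)
    have e: "ext k x = ext (\<lambda>x. max (k x) 0) x - ext (\<lambda>x. max (- k x) 0) x" for x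
      by (simp add: ext_def max_def)
    have 1: "(\<integral>x. \<phi> (norm x) * ext k (sgn x) \<partial>lborel) =
       (\<integral>x. \<phi> (norm x) * ext (\<lambda>x. max (k x) 0) (sgn x) \<partial>lborel) - (\<integral>x. \<phi> (norm x) * ext (\<lambda>x. max (- k x) 0) (sgn x) \<partial>lborel)"
      unfolding e right_diff_distrib by (intro Bochner_Integration.integral_diff int kp km \<phi>)
    have "(\<integral>x. k x \<partial>unit_sphere_measure) = (\<integral>x. max (k x) 0 - max (- k x) 0 \<partial>unit_sphere_measure)"
      by (intro Bochner_Integration.integral_cong) auto
    also have "\<dots> = (\<integral>x. max (k x) 0 \<partial>unit_sphere_measure) - (\<integral>x. max (- k x) 0 \<partial>unit_sphere_measure)"
      by (intro Bochner_Integration.integral_diff integrable_unit_sphere_measure kp km)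
    finally have 2: "(\<integral>x. k x \<partial>unit_sphere_measure)
      = (\<integral>x. max (k x) 0 \<partial>unit_sphere_measure) - (\<integral>x. max (- k x) 0 \<partial>unit_sphere_measure)" .
    show ?thesis
      using nonneg[OF kp _ \<phi>] nonneg[OF km _ \<phi>] unfolding 1 2 by (simp add: algebra_simps)
  qed
  let ?\<psi>p = "\<lambda>s. max (\<psi> s) 0" and ?\<psi>m = "\<lambda>s. max (- \<psi> s) 0"
  have \<psi>p: "continuous_on UNIV ?\<psi>p" and \<psi>m: "continuous_on UNIV ?\<psi>m"
    using \<psi> by (auto intro!: continuous_intros)
  have e: "\<psi> s = ?\<psi>p s - ?\<psi>m s" for s by (simp add: max_def)
  have 1: "(\<integral>x. \<psi> (norm x) * ext k (sgn x) \<partial>lborel) =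
     (\<integral>x. ?\<psi>p (norm x) * ext k (sgn x) \<partial>lborel) - (\<integral>x. ?\<psi>m (norm x) * ext k (sgn x) \<partial>lborel)"
    unfolding Bochner_Integration.integral_diff[OF int[OF k \<psi>p] int[OF k \<psi>m], symmetric, simplified supp, simplified]
    by (intro Bochner_Integration.integral_cong) (auto simp: max_def)
  have 2: "(\<integral>x. \<psi> (norm (x::'a)) \<partial>lborel) =
     (\<integral>x. ?\<psi>p (norm (x::'a)) \<partial>lborel) - (\<integral>x. ?\<psi>m (norm (x::'a)) \<partial>lborel)"
    unfolding Bochner_Integration.integral_diff[OF rad_int[OF \<psi>p] rad_int[OF \<psi>m], symmetric, simplified supp, simplified]
    by (intro Bochner_Integration.integral_cong) (auto simp: max_def)
  have main: "?\<omega> * (\<integral>x. \<psi> (norm x) * ext k (sgn x) \<partial>lborel)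
       = (\<integral>x. k x \<partial>unit_sphere_measure) * (\<integral>x. \<psi> (norm (x::'a)) \<partial>lborel)"
    unfolding 1 2 right_diff_distrib using half[OF \<psi>p] half[OF \<psi>m] supp by simp
  have ae: "AE x in lborel. \<psi> (norm x) * ext k (sgn x) = \<psi> (norm x) * k (sgn x)"
    using AE_lborel_singleton[of "0::'a"] by eventually_elim (auto simp: ext_def norm_sgn)
  have ms: "(\<lambda>x. \<psi> (norm x) * k (sgn x)) \<in> borel_measurable lborel"
  proof -
    have "(\<lambda>x. \<psi> (norm x) * k (sgn x)) =
      (\<lambda>x. \<psi> (norm x) * ext k (sgn x) + indicator {0} x * (\<psi> 0 * k 0))"
      by (auto simp: ext_def norm_sgn indicator_def fun_eq_iff)
    then show ?thesis
      using int[OF k \<psi> supp] by simp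
  qed
  show "integrable lborel (\<lambda>x. \<psi> (norm x) * k (sgn x))"
    using int[OF k \<psi> supp] ae ms by (blast intro: integrable_cong_AE_imp) 
  have "(\<integral>x. \<psi> (norm x) * ext k (sgn x) \<partial>lborel) = (\<integral>x. \<psi> (norm x) * k (sgn x) \<partial>lborel)"
    using int[OF k \<psi> supp] by (intro integral_cong_AE ae ms) auto
  with main show "?\<omega> * (\<integral>x. \<psi> (norm x) * k (sgn x) \<partial>lborel)
       = (\<integral>x. k x \<partial>unit_sphere_measure) * (\<integral>x. \<psi> (norm (x::'a)) \<partial>lborel)"
    by simp
qed

section \<open>The divergence theorem on the unit sphere\<close>

text \<open>Integration by parts in the form that needs no boundary: by translation invariance of Lebesgue
measure all difference quotients in direction \<open>e\<close> have integral zero, and they converge to the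
derivative boundedly on a fixed ball.\<close>

lemma integral_directional_derivative_eq_0:
  fixes f :: "'a::euclidean_space \<Rightarrow> real"
  assumes der: "\<And>x. (f has_derivative f' x) (at x)"
    and cont: "continuous_on UNIV (\<lambda>x. f' x e)"
    and supp: "\<And>x. norm x > R \<Longrightarrow> f x = 0"
  shows "(\<integral>x. f' x e \<partial>lborel) = 0"
proof -
  have contf: "continuous_on UNIV f"
    using der by (meson continuous_on_eq_continuous_at has_derivative_continuous open_UNIV)
  have f'0: "f' x e = 0" if "norm x > R" for x
  proof -
    have "(f has_derivative (\<lambda>_. 0)) (at x)"
      by (rule has_derivative_transform_within_open[of "\<lambda>_. 0" _ _ _ "- cball 0 R"])
         (use that supp in auto)
    with der[of x] have "f' x = (\<lambda>_. 0)" by (rule has_derivative_unique)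
    then show ?thesis by simp
  qed
  have "bounded ((\<lambda>x. f' x e) ` cball 0 R)"
    by (intro compact_imp_bounded compact_continuous_image continuous_on_subset[OF cont]) auto
  then obtain B0 where B0: "\<forall>x\<in>cball 0 R. \<bar>f' x e\<bar> \<le> B0"
    by (auto simp: bounded_iff)
  define B where "B = max B0 0"
  have B: "\<bar>f' x e\<bar> \<le> B" for x
    using B0 f'0[of x] by (cases "norm x \<le> R") (auto simp: B_def le_max_iff_disj)
  have gder: "((\<lambda>t. f (x + t *\<^sub>R e)) has_real_derivative f' (x + t *\<^sub>R e) e) (at t)" for x t
  proof -
    have "((\<lambda>t. f (x + t *\<^sub>R e)) has_derivative (\<lambda>s. f' (x + t *\<^sub>R e) (s *\<^sub>R e))) (at t)"
      by (rule has_derivative_compose[of "\<lambda>t. x + t *\<^sub>R e", OF _ der]) (auto intro!: derivative_eq_intros)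
    moreover have "f' (x + t *\<^sub>R e) (s *\<^sub>R e) = f' (x + t *\<^sub>R e) e * s" for s
      using linear_scale[OF has_derivative_linear[OF der]] by simp
    ultimately show ?thesis
      by (simp add: has_field_derivative_def)
  qed
  have lip: "\<bar>f (x + t *\<^sub>R e) - f x\<bar> \<le> B * \<bar>t\<bar>" for x t
    using field_differentiable_bound[of UNIV "\<lambda>t. f (x + t *\<^sub>R e)" "\<lambda>t. f' (x + t *\<^sub>R e) e" B t 0]
      gder[of x] B by (auto simp: has_field_derivative_at_within)
  have intf: "integrable lborel f"
    by (rule integrable_continuous_compact_support[OF contf supp])
  have intft: "integrable lborel (\<lambda>x. f (x + v))" and transl: "(\<integral>x. f (x + v) \<partial>lborel) = (\<integral>x. f x \<partial>lborel)" for v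
  proof -
    have [measurable]: "f \<in> borel_measurable borel"
      using contf by (rule borel_measurable_continuous_onI)
    have *: "distr lborel borel (\<lambda>x. v + x) = (lborel :: 'a measure)"
      by (rule lborel_distr_plus)
    have "integrable lborel (\<lambda>x. f (v + x))"
      using intf integrable_distr_eq[of "\<lambda>x. v + x" lborel borel f] unfolding * by simp
    then show "integrable lborel (\<lambda>x. f (x + v))"
      by (simp only: add.commute)
    have "(\<integral>x. f (v + x) \<partial>lborel) = (\<integral>x. f x \<partial>lborel)"
      using integral_distr[of "\<lambda>x. v + x" lborel borel f] unfolding * by simp
    then show "(\<integral>x. f (x + v) \<partial>lborel) = (\<integral>x. f x \<partial>lborel)"
      by (simp only: add.commute)
  qed
  \<comment> \<open>The step lengths lie in \<open>(0, 1]\<close>, so all quotients vanish off the ball of radius \<open>R + norm e\<close>.\<close>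
  define s where "s n x = (f (x + inverse (real (Suc n)) *\<^sub>R e) - f x) * real (Suc n)" for n x
  have s0: "(\<integral>x. s n x \<partial>lborel) = 0" for n
    unfolding s_def using intft[of "inverse (real (Suc n)) *\<^sub>R e"] intf transl[of "inverse (real (Suc n)) *\<^sub>R e"]
    by simp
  have "(\<lambda>n. \<integral>x. s n x \<partial>lborel) \<longlonglongrightarrow> (\<integral>x. f' x e \<partial>lborel)"
  proof (rule integral_dominated_convergence)
    show "(\<lambda>x. f' x e) \<in> borel_measurable lborel"
      using borel_measurable_continuous_onI[OF cont] by simp
    show "s n \<in> borel_measurable lborel" for n
      unfolding s_def using intft[of "inverse (real (Suc n)) *\<^sub>R e"] intf
      by (intro borel_measurable_times borel_measurable_diff) auto
    show "integrable lborel (\<lambda>x. B * indicator (cball (0::'a) (R + norm e)) x)"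
      by (intro integrable_mult_right integrable_real_indicator) (auto simp: emeasure_lborel_cball_finite[simplified])
    show "AE x in lborel. (\<lambda>n. s n x) \<longlonglongrightarrow> f' x e"
    proof (rule AE_I2)
      fix x
      have "((\<lambda>h. (f (x + h *\<^sub>R e) - f x) / h) \<longlongrightarrow> f' x e) (at 0)"
        using gder[of x 0] by (simp add: has_field_derivative_iff)
      moreover have "filterlim (\<lambda>n. inverse (real (Suc n))) (at 0) sequentially"
        using LIMSEQ_inverse_real_of_nat by (auto simp: filterlim_at)
      ultimately have "(\<lambda>n. (f (x + inverse (real (Suc n)) *\<^sub>R e) - f x) / inverse (real (Suc n))) \<longlonglongrightarrow> f' x e"
        by (rule filterlim_compose)
      then show "(\<lambda>n. s n x) \<longlonglongrightarrow> f' x e"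
        by (simp add: s_def divide_inverse)
    qed
    show "AE x in lborel. norm (s n x) \<le> B * indicator (cball 0 (R + norm e)) x" for n
    proof (rule AE_I2)
      fix x
      let ?t = "inverse (real (Suc n))"
      have t: "?t \<le> 1" by (simp add: field_simps)
      show "norm (s n x) \<le> B * indicator (cball 0 (R + norm e)) x"
      proof (cases "norm x \<le> R + norm e")
        case True
        have "\<bar>f (x + ?t *\<^sub>R e) - f x\<bar> * real (Suc n) \<le> (B * \<bar>?t\<bar>) * real (Suc n)"
          by (intro mult_right_mono lip) auto
        also have "(B * \<bar>?t\<bar>) * real (Suc n) = B" by simp
        finally show ?thesis using True by (simp add: s_def abs_mult)
      next
        case False
        have "norm x \<le> norm (x + ?t *\<^sub>R e) + norm (?t *\<^sub>R e)"
          using norm_triangle_ineq4[of "x + ?t *\<^sub>R e" "?t *\<^sub>R e"] by simp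
        also have "norm (?t *\<^sub>R e) \<le> norm e"
          using t mult_right_mono[OF t, of "norm e"] by simp
        finally have "norm (x + ?t *\<^sub>R e) > R" using False by simp
        moreover have "norm x > R" using False norm_ge_zero[of e] by linarith
        ultimately show ?thesis using False supp by (simp add: s_def)
      qed
    qed
  qed
  then show ?thesis
    by (simp add: s0 LIMSEQ_const_iff)
qed

lemma has_derivative_sgn:
  fixes x :: "'a::real_inner"
  assumes "x \<noteq> 0"
  shows "(sgn has_derivative (\<lambda>h. (h - (sgn x \<bullet> h) *\<^sub>R sgn x) /\<^sub>R norm x)) (at x)"
proof -
  have "((\<lambda>x. inverse (norm x) *\<^sub>R x) has_derivative (\<lambda>h. (h - (sgn x \<bullet> h) *\<^sub>R sgn x) /\<^sub>R norm x)) (at x)"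
    using assms
    by (auto intro!: derivative_eq_intros has_derivative_norm
      simp: sgn_div_norm algebra_simps inner_commute power2_eq_square divide_simps)
  then show ?thesis
    by (simp add: sgn_div_norm[abs_def])
qed

text \<open>A nonnegative \<open>C\<^sup>1\<close> function supported in \<open>[1, 4]\<close>.  Evaluated at \<open>(norm x)\<^sup>2\<close> it cuts off to
the shell \<open>1 \<le> norm x \<le> 2\<close>, so that fields depending on \<open>sgn x\<close> alone become \<open>C\<^sup>1\<close> on the whole
space.\<close>

definition bump :: "real \<Rightarrow> real" where "bump t = (max 0 ((t - 1) * (4 - t)))\<^sup>2"
definition bump_deriv :: "real \<Rightarrow> real" where "bump_deriv t = 2 * max 0 ((t - 1) * (4 - t)) * (5 - 2 * t)"

lemma DERIV_max_0_squared: "((\<lambda>t. (max 0 t)\<^sup>2) has_real_derivative 2 * max 0 t) (at t)"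
proof -
  consider "t > 0" | "t < 0" | "t = 0" by linarith
  then show ?thesis
  proof cases
    case 1
    have "((\<lambda>t. t\<^sup>2) has_real_derivative 2 * max 0 t) (at t)"
      using 1 by (auto intro!: derivative_eq_intros)
    then show ?thesis
      by (rule has_field_derivative_transform_within_open[of _ _ _ "{0<..}"]) (use 1 in auto)
  next
    case 2
    have "((\<lambda>t. 0) has_real_derivative 2 * max 0 t) (at t)"
      using 2 by (auto intro!: derivative_eq_intros)
    then show ?thesis
      by (rule has_field_derivative_transform_within_open[of _ _ _ "{..<0}"]) (use 2 in auto)
  next
    case 3
    have "((\<lambda>h::real. max 0 h) \<longlongrightarrow> max 0 0) (at 0)"
      by (intro tendsto_intros)
    moreover have "(\<lambda>h::real. (max 0 h)\<^sup>2 / h) = max 0"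
      by (auto simp: max_def power2_eq_square fun_eq_iff)
    ultimately have "((\<lambda>h::real. (max 0 h)\<^sup>2 / h) \<longlongrightarrow> 0) (at 0)"
      by simp
    with 3 show ?thesis
      by (simp add: has_field_derivative_iff)
  qed
qed

lemma DERIV_bump: "(bump has_real_derivative bump_deriv t) (at t)"
proof -
  have "((\<lambda>t. (t - 1) * (4 - t)) has_real_derivative (5 - 2 * t)) (at t)"
    by (auto intro!: derivative_eq_intros)
  from DERIV_chain2[OF DERIV_max_0_squared this] show ?thesis
    by (simp add: bump_def[abs_def] bump_deriv_def)
qed

lemma bump_outside: "t < 1 \<or> t > 4 \<Longrightarrow> bump t = 0"
  by (auto simp: bump_def max_def mult_le_0_iff zero_le_mult_iff)

lemma bump_deriv_outside: "t < 1 \<or> t > 4 \<Longrightarrow> bump_deriv t = 0"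
  by (auto simp: bump_deriv_def max_def mult_le_0_iff zero_le_mult_iff)

lemma bump_nonneg: "0 \<le> bump t" by (simp add: bump_def)

lemma bump_pos: "1 < t \<Longrightarrow> t < 4 \<Longrightarrow> 0 < bump t"
  by (simp add: bump_def max_def not_le)

lemma continuous_on_bump: "continuous_on A bump"
  unfolding bump_def[abs_def] by (intro continuous_intros)

lemma continuous_on_bump_deriv: "continuous_on A bump_deriv"
  unfolding bump_deriv_def[abs_def] by (intro continuous_intros)

lemma linear_eq_sum_Basis:
  fixes T :: "'a::euclidean_space \<Rightarrow> 'b::real_vector"
  assumes "linear T"
  shows "T v = (\<Sum>b\<in>Basis. (v \<bullet> b) *\<^sub>R T b)"
  using linear_sum[OF assms, of "\<lambda>b. (v \<bullet> b) *\<^sub>R b" Basis] linear_scale[OF assms]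
  by (simp add: euclidean_representation)

lemma continuous_on_bump_over: "continuous_on UNIV (\<lambda>s. bump (s\<^sup>2) / s)"
proof -
  have "continuous_on {-1<..<1} (\<lambda>s. bump (s\<^sup>2) / s)"
    by (rule continuous_on_eq[of _ "\<lambda>_. 0"]) (auto simp: abs_square_less_1 abs_less_iff bump_outside)
  moreover have "continuous_on (- {0}) (\<lambda>s. bump (s\<^sup>2) / s)"
    by (intro continuous_intros continuous_on_compose2[OF continuous_on_bump]) auto
  ultimately have "continuous_on ({-1<..<1} \<union> - {0}) (\<lambda>s. bump (s\<^sup>2) / s)"
    by (intro continuous_on_open_Un) auto
  moreover have "{-1<..<1} \<union> - {0::real} = UNIV" by auto
  ultimately show ?thesis by simp
qed

lemma bump_over_outside: "2 < s \<Longrightarrow> bump (s\<^sup>2) / s = 0"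
  using power_strict_mono[of 2 s 2] by (simp add: bump_outside)

text \<open>Extend \<open>F\<close> from the sphere to the field \<open>F (sgn x)\<close>, constant along rays, and multiply it by the
cut-off.  Both terms of the divergence of the product are a radial function times a function of
\<open>sgn x\<close>: where the cut-off is differentiated only the normal component of \<open>F\<close> survives, and where
\<open>F\<close> is differentiated only its tangential divergence, because the derivative of \<open>sgn\<close> projects onto
the tangent space.  The divergence has integral zero, and polar separation turns this into a
relation between the two spherical integrals.\<close>

lemma sphere_divergence_bump:
  fixes F :: "'a::euclidean_space \<Rightarrow> 'a" and F' :: "'a \<Rightarrow> 'a \<Rightarrow> 'a"
  assumes der: "\<And>z. norm z = 1 \<Longrightarrow> (F has_derivative F' z) (at z)"
    and cont: "\<And>b. b \<in> Basis \<Longrightarrow> continuous_on (sphere 0 1) (\<lambda>z. F' z b)"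
  shows "(\<integral>z. F z \<bullet> z \<partial>unit_sphere_measure) * (\<integral>x. 2 * bump_deriv ((norm (x::'a))\<^sup>2) * norm x \<partial>lborel)
    + (\<integral>z. (\<Sum>b\<in>Basis. F' z b \<bullet> b) - F' z z \<bullet> z \<partial>unit_sphere_measure)
        * (\<integral>x. bump ((norm (x::'a))\<^sup>2) / norm x \<partial>lborel) = 0"
proof -
  \<comment> \<open>\<open>V h x\<close> is the derivative of \<open>sgn\<close> at \<open>x\<close> in direction \<open>h\<close>.\<close>
  define V where "V e x = (e - (sgn x \<bullet> e) *\<^sub>R sgn x) /\<^sub>R norm x" for e x :: 'a
  define \<Phi> where "\<Phi> b x = bump ((norm x)\<^sup>2) * (F (sgn x) \<bullet> b)" for b x
  define \<Phi>' where "\<Phi>' b x h = (if x = 0 then 0 else bump_deriv ((norm x)\<^sup>2) * (2 * (x \<bullet> h)) * (F (sgn x) \<bullet> b)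
      + bump ((norm x)\<^sup>2) * (F' (sgn x) (V h x) \<bullet> b))" for b x h
  have small: "(norm x)\<^sup>2 < 1" if "norm x < 1" for x :: 'a
    using that by (simp add: power_less_one_iff abs_square_less_1)
  have \<Phi>'_small: "\<Phi>' b x h = 0" if "norm x < 1" for b x h
    using small[OF that] by (simp add: \<Phi>'_def bump_outside bump_deriv_outside)
  have \<Phi>_small: "\<Phi> b x = 0" if "norm x < 1" for b x
    using small[OF that] by (simp add: \<Phi>_def bump_outside)
  have big: "(norm x)\<^sup>2 > 4" if "norm x > 2" for x :: 'a
    using that power_strict_mono[of 2 "norm x" 2] by simp
  have lin: "linear (F' z)" if "norm z = 1" for z
    using der[OF that] by (rule has_derivative_linear)
  have contF: "continuous_on (sphere 0 1) F"
    using der by (meson continuous_at_imp_continuous_on has_derivative_continuous mem_sphere_0)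
  have contF'v: "continuous_on (sphere 0 1) (\<lambda>z. F' z (v z))" if v: "continuous_on (sphere 0 1) v" for v
  proof -
    have "continuous_on (sphere 0 1) (\<lambda>z. \<Sum>b\<in>Basis. (v z \<bullet> b) *\<^sub>R F' z b)"
      by (intro continuous_intros cont v)
    then show ?thesis
      by (rule continuous_on_eq) (simp add: linear_eq_sum_Basis[OF lin, symmetric])
  qed
  \<comment> \<open>The formula for \<open>\<Phi>'\<close> breaks down at the origin, but near the origin the cut-off vanishes.\<close>
  have der\<Phi>: "(\<Phi> b has_derivative \<Phi>' b x) (at x)" for b x
  proof (cases "norm x < 1")
    case True
    have "((\<lambda>_. 0) has_derivative \<Phi>' b x) (at x)"
      unfolding \<Phi>'_small[OF True] by simp
    then show ?thesis
      by (rule has_derivative_transform_within_open[of _ _ _ _ "ball 0 1"]) (use True \<Phi>_small in auto)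
  next
    case False
    then have x0: "x \<noteq> 0" by auto
    have 1: "((\<lambda>x. bump ((norm x)\<^sup>2)) has_derivative (\<lambda>h. bump_deriv ((norm x)\<^sup>2) * (2 * (x \<bullet> h)))) (at x)"
    proof -
      have "((\<lambda>x::'a. (norm x)\<^sup>2) has_derivative (\<lambda>h. 2 * (x \<bullet> h))) (at x)"
        unfolding power2_norm_eq_inner by (auto intro!: derivative_eq_intros simp: inner_commute)
      from has_derivative_compose[OF this DERIV_bump[unfolded has_field_derivative_def]]
      show ?thesis .
    qed
    have 2: "((\<lambda>x. F (sgn x)) has_derivative (\<lambda>h. F' (sgn x) (V h x))) (at x)"
      unfolding V_def using x0
      by (intro has_derivative_compose[OF has_derivative_sgn der]) (auto simp: norm_sgn)
    have "((\<lambda>x. bump ((norm x)\<^sup>2) * (F (sgn x) \<bullet> b)) has_derivative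
      (\<lambda>h. bump ((norm x)\<^sup>2) * (F' (sgn x) (V h x) \<bullet> b)
          + bump_deriv ((norm x)\<^sup>2) * (2 * (x \<bullet> h)) * (F (sgn x) \<bullet> b))) (at x)"
      by (rule has_derivative_mult[OF 1 has_derivative_inner_left[OF 2]])
    then show ?thesis
      using x0 by (simp add: \<Phi>_def[abs_def] \<Phi>'_def[abs_def] add.commute)
  qed
  have csgn: "continuous_on (- {0::'a}) sgn"
    by (intro continuous_intros) auto
  have img: "sgn ` (- {0::'a}) \<subseteq> sphere 0 1"
    by (auto simp: norm_sgn split: if_splits)
  have cF: "continuous_on (- {0}) (\<lambda>x. F (sgn x))"
    by (rule continuous_on_compose2[OF contF csgn img])
  have cF': "continuous_on (- {0}) (\<lambda>x. F' (sgn x) b)" if "b \<in> Basis" for b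
    by (rule continuous_on_compose2[OF cont[OF that] csgn img])
  have cont\<Phi>': "continuous_on UNIV (\<lambda>x. \<Phi>' b x h)" for b h
  proof -
    have "continuous_on (ball 0 1) (\<lambda>x. \<Phi>' b x h)"
      by (rule continuous_on_eq[of _ "\<lambda>_. 0"]) (auto simp: \<Phi>'_small)
    moreover have "continuous_on (- {0}) (\<lambda>x. \<Phi>' b x h)"
    proof (rule continuous_on_eq)
      show "continuous_on (- {0}) (\<lambda>x. bump_deriv ((norm x)\<^sup>2) * (2 * (x \<bullet> h)) * (F (sgn x) \<bullet> b)
         + bump ((norm x)\<^sup>2) * ((\<Sum>c\<in>Basis. (V h x \<bullet> c) *\<^sub>R F' (sgn x) c) \<bullet> b))"
        unfolding V_def
        by (intro continuous_intros cF cF' csgn continuous_on_compose2[OF continuous_on_bump]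
            continuous_on_compose2[OF continuous_on_bump_deriv]) auto
    qed (auto simp: \<Phi>'_def norm_sgn linear_eq_sum_Basis[OF lin, symmetric])
    ultimately have "continuous_on (ball 0 1 \<union> - {0}) (\<lambda>x. \<Phi>' b x h)"
      by (intro continuous_on_open_Un) auto
    moreover have "ball 0 1 \<union> - {0::'a} = UNIV" by auto
    ultimately show ?thesis by simp
  qed
  have int0: "(\<integral>x. \<Phi>' b x b \<partial>lborel) = 0" for b
    by (rule integral_directional_derivative_eq_0[OF der\<Phi> cont\<Phi>', where R=2])
       (auto simp: \<Phi>_def dest!: big intro!: bump_outside)
  have intble: "integrable lborel (\<lambda>x. \<Phi>' b x b)" for b
    by (rule integrable_continuous_compact_support[OF cont\<Phi>', where R=2])
       (auto simp: \<Phi>'_def bump_outside bump_deriv_outside dest!: big)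
  define k1 where "k1 z = (\<Sum>b\<in>Basis. F' z b \<bullet> b) - F' z z \<bullet> z" for z
  define k2 where "k2 z = F z \<bullet> z" for z
  define \<psi>1 where "\<psi>1 s = bump (s\<^sup>2) / s" for s :: real
  define \<psi>2 where "\<psi>2 s = 2 * bump_deriv (s\<^sup>2) * s" for s :: real
  have c1: "continuous_on UNIV \<psi>1"
    unfolding \<psi>1_def[abs_def] by (rule continuous_on_bump_over)
  have c2: "continuous_on UNIV \<psi>2"
    unfolding \<psi>2_def by (intro continuous_intros continuous_on_compose2[OF continuous_on_bump_deriv]) auto
  have s1: "\<psi>1 s = 0" and s2: "\<psi>2 s = 0" if "s > 2" for s
    using that power_strict_mono[of 2 s 2] by (auto simp: \<psi>1_def \<psi>2_def bump_outside bump_deriv_outside)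
  have ck1: "continuous_on (sphere 0 1) k1"
    unfolding k1_def[abs_def] by (intro continuous_intros cont contF'v)
  have ck2: "continuous_on (sphere 0 1) k2"
    unfolding k2_def[abs_def] by (intro continuous_intros contF)
  have id: "(\<Sum>b\<in>Basis. \<Phi>' b x b) = \<psi>2 (norm x) * k2 (sgn x) + \<psi>1 (norm x) * k1 (sgn x)" for x
  proof (cases "x = 0")
    case True then show ?thesis by (simp add: \<Phi>'_def \<psi>1_def \<psi>2_def)
  next
    case False
    define n where "n = sgn x"
    have n: "norm n = 1" using False by (simp add: n_def norm_sgn)
    have x: "x = norm x *\<^sub>R n" using False by (simp add: n_def sgn_div_norm)
    have A: "(\<Sum>b\<in>Basis. (x \<bullet> b) * (F n \<bullet> b)) = norm x * k2 n"
    proof -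
      have "(\<Sum>b\<in>Basis. (x \<bullet> b) * (F n \<bullet> b)) = x \<bullet> F n"
        by (rule euclidean_inner[symmetric])
      also have "\<dots> = (norm x *\<^sub>R n) \<bullet> F n" by (rule arg_cong[OF x])
      finally show ?thesis by (simp add: k2_def inner_commute)
    qed
    have B: "F' n (V b x) \<bullet> b = (F' n b \<bullet> b - (n \<bullet> b) * (F' n n \<bullet> b)) / norm x" for b
      unfolding V_def n_def[symmetric]
      by (simp add: linear_scale[OF lin[OF n]] linear_diff[OF lin[OF n]] inner_diff_left divide_inverse mult.commute)
    have C: "(\<Sum>b\<in>Basis. F' n (V b x) \<bullet> b) = k1 n / norm x"
      unfolding B k1_def by (simp add: sum_divide_distrib[symmetric] sum_subtractf euclidean_inner[of "F' n n" n] mult.commute)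
    have "(\<Sum>b\<in>Basis. \<Phi>' b x b) = 2 * bump_deriv ((norm x)\<^sup>2) * (\<Sum>b\<in>Basis. (x \<bullet> b) * (F n \<bullet> b))
        + bump ((norm x)\<^sup>2) * (\<Sum>b\<in>Basis. F' n (V b x) \<bullet> b)"
      using False by (simp add: \<Phi>'_def n_def sum.distrib sum_distrib_left mult_ac)
    then show ?thesis
      unfolding A C by (simp add: \<psi>1_def \<psi>2_def n_def)
  qed
  have "0 = (\<integral>x. (\<Sum>b\<in>Basis. \<Phi>' b x b) \<partial>lborel)"
    by (simp add: Bochner_Integration.integral_sum[OF intble] int0)
  also have "\<dots> = (\<integral>x. \<psi>2 (norm x) * k2 (sgn x) \<partial>lborel) + (\<integral>x. \<psi>1 (norm x) * k1 (sgn x) \<partial>lborel)"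
    unfolding id
    by (intro Bochner_Integration.integral_add integral_polar_separation(1)[where b=2] ck1 ck2 c1 c2 s1 s2)
  finally have "measure unit_sphere_measure (sphere (0::'a) 1) * (\<integral>x. \<psi>2 (norm x) * k2 (sgn x) \<partial>lborel)
     + measure unit_sphere_measure (sphere (0::'a) 1) * (\<integral>x. \<psi>1 (norm x) * k1 (sgn x) \<partial>lborel) = 0"
    by (metis distrib_left mult_zero_right)
  then have "(\<integral>z. k2 z \<partial>unit_sphere_measure) * (\<integral>x. \<psi>2 (norm (x::'a)) \<partial>lborel)
     + (\<integral>z. k1 z \<partial>unit_sphere_measure) * (\<integral>x. \<psi>1 (norm (x::'a)) \<partial>lborel) = 0"
    using integral_polar_separation(2)[OF ck2 c2 s2] integral_polar_separation(2)[OF ck1 c1 s1] by simp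
  then show ?thesis
    by (simp add: k1_def k2_def \<psi>1_def \<psi>2_def)
qed

text \<open>The divergence theorem on the unit sphere: the tangential divergence of \<open>F\<close> and its normal
component are related through the mean curvature.  The two radial constants in the preceding lemma
do not depend on \<open>F\<close>; taking the identity for \<open>F\<close> determines their ratio, so they need not be
computed.\<close>

lemma sphere_divergence:
  fixes F :: "'a::euclidean_space \<Rightarrow> 'a" and F' :: "'a \<Rightarrow> 'a \<Rightarrow> 'a"
  assumes der: "\<And>z. norm z = 1 \<Longrightarrow> (F has_derivative F' z) (at z)"
    and cont: "\<And>b. b \<in> Basis \<Longrightarrow> continuous_on (sphere 0 1) (\<lambda>z. F' z b)"
  shows "(\<integral>z. (\<Sum>b\<in>Basis. F' z b \<bullet> b) - F' z z \<bullet> z \<partial>unit_sphere_measure)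
    = (real DIM('a) - 1) * (\<integral>z. F z \<bullet> z \<partial>unit_sphere_measure)"
proof -
  define c1 where "c1 = (\<integral>x. bump ((norm (x::'a))\<^sup>2) / norm x \<partial>lborel)"
  define c2 where "c2 = (\<integral>x. 2 * bump_deriv ((norm (x::'a))\<^sup>2) * norm x \<partial>lborel)"
  define S where "S = measure unit_sphere_measure (sphere (0::'a) 1)"
  have int_const: "(\<integral>z. c \<partial>(unit_sphere_measure :: 'a measure)) = S * c" for c :: real
    by (simp add: S_def space_unit_sphere_measure)
  have sphere_const: "(\<integral>z. f z \<partial>(unit_sphere_measure :: 'a measure)) = S * c"
    if "\<And>z. norm z = 1 \<Longrightarrow> f z = c" for f and c :: real
    unfolding int_const[symmetric]
    by (rule Bochner_Integration.integral_cong) (auto simp: that space_unit_sphere_measure)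
  have "S > 0" by (simp add: S_def measure_unit_sphere)
  have "(\<integral>z. z \<bullet> z \<partial>(unit_sphere_measure :: 'a measure)) * c2
      + (\<integral>z. (\<Sum>b\<in>Basis. b \<bullet> (b::'a)) - z \<bullet> z \<partial>(unit_sphere_measure :: 'a measure)) * c1 = 0"
    unfolding c1_def c2_def
    by (rule sphere_divergence_bump[of "\<lambda>z. z" "\<lambda>z h. h"]) (auto intro!: continuous_intros)
  also have "(\<integral>z. z \<bullet> z \<partial>(unit_sphere_measure :: 'a measure)) = S * 1"
    by (rule sphere_const) (simp add: dot_square_norm)
  also have "(\<integral>z. (\<Sum>b\<in>Basis. b \<bullet> (b::'a)) - z \<bullet> z \<partial>(unit_sphere_measure :: 'a measure)) = S * (real DIM('a) - 1)"
    by (rule sphere_const) (simp add: dot_square_norm)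
  finally have "S * (c2 + (real DIM('a) - 1) * c1) = 0"
    by (simp add: algebra_simps)
  with \<open>S > 0\<close> have "c2 + (real DIM('a) - 1) * c1 = 0"
    by simp
  then have c2: "c2 = - (real DIM('a) - 1) * c1"
    by (simp add: algebra_simps)
  have c1: "c1 > 0"
  proof -
    let ?f = "\<lambda>x::'a. bump ((norm x)\<^sup>2) / norm x"
    obtain b :: 'a where b: "b \<in> Basis" using nonempty_Basis by blast
    have pos: "?f x > 0" if "x \<in> ball ((3/2) *\<^sub>R b) (1/4)" for x
    proof -
      have "\<bar>norm x - norm ((3/2) *\<^sub>R b)\<bar> \<le> norm (x - (3/2) *\<^sub>R b)"
        by (rule norm_triangle_ineq3)
      also have "\<dots> < 1/4" using that by (simp add: dist_norm norm_minus_commute)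
      finally have "\<bar>norm x - 3/2\<bar> < 1/4" using b by simp
      then have x: "1 < norm x" "norm x < 2" by linarith+
      then have "1 < (norm x)\<^sup>2" "(norm x)\<^sup>2 < 4"
        using power_strict_mono[of "norm x" 2 2] by (auto simp: one_less_power)
      then have "0 < bump ((norm x)\<^sup>2)" by (rule bump_pos)
      moreover have "0 < norm x" using x by linarith
      ultimately show ?thesis by (rule divide_pos_pos)
    qed
    have int: "integrable lborel ?f"
      using integral_polar_separation(1)[OF _ continuous_on_bump_over, of "\<lambda>_. 1" 2] by (simp add: bump_over_outside)
    have "c1 \<noteq> 0"
    proof
      assume "c1 = 0"
      then have "AE x in lborel. ?f x = 0"
        using integral_nonneg_eq_0_iff_AE[OF int] by (simp add: c1_def bump_nonneg)
      then have "AE x in lborel. \<not> x \<in> ball ((3/2) *\<^sub>R b) (1/4)"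
        by eventually_elim (use pos in force)
      then have "emeasure lborel {x \<in> space lborel. x \<in> ball ((3/2) *\<^sub>R b) (1/4)} = 0"
        by (rule emeasure_eq_0_AE)
      then have "emeasure lborel (ball ((3/2) *\<^sub>R b) (1/4)) = 0"
        by (simp del: mem_ball)
      then show False
        using unit_ball_vol_pos[of "real DIM('a)"] by (simp add: emeasure_ball)
    qed
    moreover have "c1 \<ge> 0"
      unfolding c1_def by (intro Bochner_Integration.integral_nonneg) (simp add: bump_nonneg)
    ultimately show ?thesis by simp
  qed
  have "c1 * ((\<integral>z. (\<Sum>b\<in>Basis. F' z b \<bullet> b) - F' z z \<bullet> z \<partial>unit_sphere_measure)
    - (real DIM('a) - 1) * (\<integral>z. F z \<bullet> z \<partial>unit_sphere_measure)) = 0"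
    using sphere_divergence_bump[OF der cont] unfolding c1_def[symmetric] c2_def[symmetric] c2
    by (simp add: algebra_simps)
  with c1 show ?thesis by simp
qed

section \<open>Derivatives of spherical means\<close>

text \<open>Differentiation under the integral sign; the mean value theorem bounds the difference quotients by
the bound on the derivative, which is integrable as the measure is finite.\<close>

lemma has_real_derivative_integral_parameter:
  fixes f :: "real \<Rightarrow> 'b \<Rightarrow> real"
  assumes fin: "finite_measure M" and r: "r \<in> {a<..<b}"
    and int: "\<And>s. s \<in> {a<..<b} \<Longrightarrow> integrable M (f s)"
    and meas: "f' r \<in> borel_measurable M"
    and der: "\<And>s x. s \<in> {a<..<b} \<Longrightarrow> x \<in> space M \<Longrightarrow> ((\<lambda>s. f s x) has_real_derivative f' s x) (at s)"
    and bound: "\<And>s x. s \<in> {a<..<b} \<Longrightarrow> x \<in> space M \<Longrightarrow> \<bar>f' s x\<bar> \<le> B"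
  shows "((\<lambda>s. \<integral>x. f s x \<partial>M) has_real_derivative (\<integral>x. f' r x \<partial>M)) (at r)"
proof -
  interpret finite_measure M by (rule fin)
  have lip: "\<bar>f s x - f r x\<bar> \<le> B * \<bar>s - r\<bar>" if "s \<in> {a<..<b}" "x \<in> space M" for s x
    using field_differentiable_bound[of "{a<..<b}" "\<lambda>s. f s x" "\<lambda>s. f' s x" B s r] der bound that r
    by (auto simp: has_field_derivative_at_within)
  have "((\<lambda>s. ((\<integral>x. f s x \<partial>M) - (\<integral>x. f r x \<partial>M)) / (s - r)) \<longlongrightarrow> (\<integral>x. f' r x \<partial>M)) (at r)"
  proof (subst tendsto_at_iff_sequentially, intro allI impI)
    fix X :: "nat \<Rightarrow> real"
    assume X: "\<forall>i. X i \<in> UNIV - {r}" "X \<longlonglongrightarrow> r"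
    have "eventually (\<lambda>i. X i \<in> {a<..<b}) sequentially"
      using X(2) r by (intro topological_tendstoD) auto
    then obtain K where K: "\<And>i. i \<ge> K \<Longrightarrow> X i \<in> {a<..<b}"
      by (auto simp: eventually_sequentially)
    define Y where "Y i = X (i + K)" for i
    have Y: "Y i \<in> {a<..<b}" "Y i \<noteq> r" for i
      using K X(1) by (auto simp: Y_def)
    have Ylim: "Y \<longlonglongrightarrow> r"
      unfolding Y_def using X(2) by (rule LIMSEQ_ignore_initial_segment)
    have "(\<lambda>i. \<integral>x. (f (Y i) x - f r x) / (Y i - r) \<partial>M) \<longlonglongrightarrow> (\<integral>x. f' r x \<partial>M)"
    proof (rule integral_dominated_convergence[where w="\<lambda>_. B"])
      show "(\<lambda>x. (f (Y i) x - f r x) / (Y i - r)) \<in> borel_measurable M" for i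
        using int[OF Y(1)[of i]] int[OF r] by auto
      show "AE x in M. (\<lambda>i. (f (Y i) x - f r x) / (Y i - r)) \<longlonglongrightarrow> f' r x"
      proof (rule AE_I2)
        fix x assume "x \<in> space M"
        then have "((\<lambda>s. (f s x - f r x) / (s - r)) \<longlongrightarrow> f' r x) (at r)"
          using der[OF r] by (simp add: has_field_derivative_iff)
        moreover have "filterlim Y (at r) sequentially"
          using Ylim Y(2) by (simp add: filterlim_at)
        ultimately show "(\<lambda>i. (f (Y i) x - f r x) / (Y i - r)) \<longlonglongrightarrow> f' r x"
          by (rule filterlim_compose)
      qed
      show "AE x in M. norm ((f (Y i) x - f r x) / (Y i - r)) \<le> B" for i
        using lip[OF Y(1)[of i]] Y(2)[of i] by (intro AE_I2) (simp add: abs_divide divide_simps)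
    qed (use meas in auto)
    also have "(\<lambda>i. \<integral>x. (f (Y i) x - f r x) / (Y i - r) \<partial>M) =
        (\<lambda>i. ((\<integral>x. f (Y i) x \<partial>M) - (\<integral>x. f r x \<partial>M)) / (Y i - r))"
      using int[OF Y(1)] int[OF r] by simp
    finally show "((\<lambda>s. ((\<integral>x. f s x \<partial>M) - (\<integral>x. f r x \<partial>M)) / (s - r)) \<circ> X) \<longlonglongrightarrow> (\<integral>x. f' r x \<partial>M)"
      unfolding Y_def comp_def
      by (rule LIMSEQ_offset[where k=K, of "\<lambda>i. ((\<integral>x. f (X i) x \<partial>M) - (\<integral>x. f r x \<partial>M)) / (X i - r)"])
  qed
  then show ?thesis
    by (simp add: has_field_derivative_iff)
qed

definition exterior :: "real \<Rightarrow> 'a::euclidean_space set" where "exterior r\<^sub>0 = {x. norm x > r\<^sub>0}"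

lemma C1_on_has_derivative:
  assumes "C1_on S f" "x \<in> S"
  shows "(f has_derivative (\<lambda>h. gradient f x \<bullet> h)) (at x)"
proof -
  have d: "(f has_derivative frechet_derivative f (at x)) (at x)"
    using assms by (auto simp: C1_on_def frechet_derivative_works)
  have "frechet_derivative f (at x) = (\<lambda>h. gradient f x \<bullet> h)"
  proof
    fix h
    show "frechet_derivative f (at x) h = gradient f x \<bullet> h"
      using linear_eq_sum_Basis[OF has_derivative_linear[OF d], of h]
      by (simp add: gradient_def partial_deriv_def inner_sum_left mult.commute inner_commute[of h])
  qed
  with d show ?thesis by (simp only:)
qed

lemma C1_on_continuous_on: "C1_on S f \<Longrightarrow> continuous_on S f"
  by (meson C1_on_has_derivative continuous_at_imp_continuous_on has_derivative_continuous)

lemma C1_on_continuous_on_gradient: "C1_on S f \<Longrightarrow> continuous_on S (gradient f)"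
  unfolding gradient_def[abs_def] C1_on_def by (intro continuous_intros) auto

lemma continuous_on_sphere_scale:
  fixes f :: "'a::euclidean_space \<Rightarrow> 'b::topological_space"
  assumes "continuous_on (exterior r\<^sub>0) f" "r > r\<^sub>0" "r\<^sub>0 > 0"
  shows "continuous_on (sphere 0 1) (\<lambda>x. f (r *\<^sub>R x))"
  by (rule continuous_on_compose2[OF assms(1)]) (use assms in \<open>auto simp: exterior_def intro!: continuous_intros\<close>)

text \<open>The weight \<open>c\<close> makes the lemma apply twice: with weight one to \<open>u\<close> itself, and with the coordinates
of \<open>x\<close> as weights to the partial derivatives of \<open>u\<close>.\<close>

lemma DERIV_sphere_integral:
  fixes g c :: "'a::euclidean_space \<Rightarrow> real"
  assumes r\<^sub>0: "r\<^sub>0 > 0" and g: "C1_on (exterior r\<^sub>0) g" and c: "continuous_on (sphere 0 1) c" and r: "r > r\<^sub>0"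
  shows "((\<lambda>s. \<integral>x. g (s *\<^sub>R x) * c x \<partial>unit_sphere_measure) has_real_derivative
      (\<integral>x. (gradient g (r *\<^sub>R x) \<bullet> x) * c x \<partial>unit_sphere_measure)) (at r)"
proof -
  define a where "a = (r\<^sub>0 + r) / 2"
  define b where "b = r + 1"
  have ab: "r\<^sub>0 < a" "a < r" "r < b" using r by (auto simp: a_def b_def)
  have "bounded (gradient g ` (cball 0 b - ball 0 a))"
    using ab by (intro compact_imp_bounded compact_continuous_image compact_diff
        continuous_on_subset[OF C1_on_continuous_on_gradient[OF g]]) (auto simp: exterior_def)
  then obtain B1 where B1: "\<forall>y\<in>cball 0 b - ball 0 a. norm (gradient g y) \<le> B1"
    by (auto simp: bounded_iff)
  have "bounded (c ` sphere 0 1)"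
    using c by (intro compact_imp_bounded compact_continuous_image) auto
  then obtain B2 where B2: "\<forall>x\<in>sphere 0 1. \<bar>c x\<bar> \<le> B2"
    by (auto simp: bounded_iff)
  have c': "continuous_on (sphere 0 1) (\<lambda>x. (gradient g (s *\<^sub>R x) \<bullet> x) * c x)" if "s > r\<^sub>0" for s
    by (intro continuous_intros c continuous_on_sphere_scale[OF C1_on_continuous_on_gradient[OF g]] that r\<^sub>0)
  show ?thesis
  proof (rule has_real_derivative_integral_parameter[where f'="\<lambda>s x. (gradient g (s *\<^sub>R x) \<bullet> x) * c x"
        and a=a and b=b and B="B1 * B2"])
    show "finite_measure (unit_sphere_measure :: 'a measure)" by (rule finite_unit_sphere_measure)
    show "r \<in> {a<..<b}" using ab by simp
    fix s assume "s \<in> {a<..<b}"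
    then have s: "a < s" "s < b" "r\<^sub>0 < s" "0 < s" using ab r\<^sub>0 by auto
    show "integrable unit_sphere_measure (\<lambda>x. g (s *\<^sub>R x) * c x)"
      by (intro integrable_unit_sphere_measure continuous_intros c
          continuous_on_sphere_scale[OF C1_on_continuous_on[OF g]] s r\<^sub>0)
    fix x :: 'a assume "x \<in> space unit_sphere_measure"
    then have x: "norm x = 1" by (simp add: space_unit_sphere_measure)
    have "((\<lambda>s. g (s *\<^sub>R x)) has_derivative (\<lambda>h. gradient g (s *\<^sub>R x) \<bullet> (h *\<^sub>R x))) (at s)"
      by (rule has_derivative_compose[OF _ C1_on_has_derivative[OF g]])
         (use s x in \<open>auto intro!: derivative_eq_intros simp: exterior_def\<close>)
    then have "((\<lambda>s. g (s *\<^sub>R x)) has_real_derivative (gradient g (s *\<^sub>R x) \<bullet> x)) (at s)"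
      by (simp add: has_field_derivative_def mult.commute[of _ "gradient _ _ \<bullet> _"])
    then show "((\<lambda>s. g (s *\<^sub>R x) * c x) has_real_derivative (gradient g (s *\<^sub>R x) \<bullet> x) * c x) (at s)"
      by (rule DERIV_cmult_right)
    have "\<bar>gradient g (s *\<^sub>R x) \<bullet> x\<bar> \<le> norm (gradient g (s *\<^sub>R x)) * norm x"
      by (rule Cauchy_Schwarz_ineq2)
    also have "\<dots> \<le> B1" using B1 s x by simp
    finally show "\<bar>(gradient g (s *\<^sub>R x) \<bullet> x) * c x\<bar> \<le> B1 * B2"
      unfolding abs_mult using B2 x by (intro mult_mono) auto
  qed (use integrable_unit_sphere_measure[OF c'[OF r]] in auto)
qed

definition mean_normal_deriv :: "('a::euclidean_space \<Rightarrow> real) \<Rightarrow> real \<Rightarrow> real"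
  where "mean_normal_deriv u r = (\<integral>x. gradient u (r *\<^sub>R x) \<bullet> x \<partial>unit_sphere_measure) / measure (unit_sphere_measure :: 'a measure) (sphere 0 1)"

lemma DERIV_spherical_mean:
  fixes u :: "'a::euclidean_space \<Rightarrow> real"
  assumes "r\<^sub>0 > 0" "C1_on (exterior r\<^sub>0) u" "r > r\<^sub>0"
  shows "(spherical_mean u has_real_derivative mean_normal_deriv u r) (at r)"
  using DERIV_cdivide[OF DERIV_sphere_integral[OF assms(1,2) _ assms(3), of "\<lambda>_. 1"]]
  unfolding spherical_mean_def[abs_def] mean_normal_deriv_def by simp

text \<open>This is the divergence theorem for shells in differential form: the flux of the gradient through the
sphere of radius \<open>r\<close> grows at the rate given by the integral of the Laplacian over that sphere.  The
derivative of the mean of \<open>\<nabla>u \<cdot> x\<close> contains only the second derivative of \<open>u\<close> in the normal direction;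
the divergence theorem on the unit sphere, applied to the gradient field of \<open>u\<close> rescaled by \<open>r\<close>,
supplies the rest of the Laplacian.\<close>

lemma DERIV_flux:
  fixes u :: "'a::euclidean_space \<Rightarrow> real"
  assumes r\<^sub>0: "r\<^sub>0 > 0" and u: "C2_on (exterior r\<^sub>0) u" and r: "r > r\<^sub>0"
  shows "((\<lambda>r. r powr (real DIM('a) - 1) * mean_normal_deriv u r) has_real_derivative
     r powr (real DIM('a) - 1) * spherical_mean (laplacian u) r) (at r)"
proof -
  let ?g = "\<lambda>b. partial_deriv b u"
  let ?\<sigma> = "unit_sphere_measure :: 'a measure"
  let ?\<omega> = "measure ?\<sigma> (sphere 0 1)"
  have r0: "r > 0" using r r\<^sub>0 by simp
  have g: "C1_on (exterior r\<^sub>0) (?g b)" if "b \<in> Basis" for b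
    using u that by (simp add: C2_on_def)
  have gradu: "gradient u y = (\<Sum>b\<in>Basis. ?g b y *\<^sub>R b)" for y
    by (simp add: gradient_def)
  have gradu_inner: "gradient u y \<bullet> z = (\<Sum>b\<in>Basis. ?g b y * (z \<bullet> b))" for y z
    by (simp add: gradu inner_sum_left inner_commute[of z])
  have cg: "continuous_on (sphere 0 1) (\<lambda>z. ?g b (s *\<^sub>R z) * (z \<bullet> b))" if "b \<in> Basis" "s > r\<^sub>0" for b s
    by (intro continuous_intros continuous_on_sphere_scale[OF C1_on_continuous_on[OF g]] that r\<^sub>0)
  have cgg: "continuous_on (sphere 0 1) (\<lambda>z. (gradient (?g b) (r *\<^sub>R z) \<bullet> z) * (z \<bullet> b))" if "b \<in> Basis" for b
    by (intro continuous_intros continuous_on_sphere_scale[OF C1_on_continuous_on_gradient[OF g]] that r r\<^sub>0)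
  have clap: "continuous_on (sphere 0 1) (\<lambda>z. laplacian u (r *\<^sub>R z))"
    unfolding laplacian_def using u r r\<^sub>0
    by (intro continuous_intros continuous_on_sphere_scale) (auto simp: C2_on_def C1_on_def)
  define A where "A s = (\<integral>z. gradient u (s *\<^sub>R z) \<bullet> z \<partial>?\<sigma>)" for s
  define A' where "A' = (\<integral>z. (\<Sum>b\<in>Basis. (gradient (?g b) (r *\<^sub>R z) \<bullet> z) * (z \<bullet> b)) \<partial>?\<sigma>)"
  have A: "A s = (\<Sum>b\<in>Basis. \<integral>z. ?g b (s *\<^sub>R z) * (z \<bullet> b) \<partial>?\<sigma>)" if "s > r\<^sub>0" for s
    unfolding A_def gradu_inner
    by (intro Bochner_Integration.integral_sum integrable_unit_sphere_measure cg that)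
  have A'eq: "A' = (\<Sum>b\<in>Basis. \<integral>z. (gradient (?g b) (r *\<^sub>R z) \<bullet> z) * (z \<bullet> b) \<partial>?\<sigma>)"
    unfolding A'_def by (intro Bochner_Integration.integral_sum integrable_unit_sphere_measure cgg)
  have "((\<lambda>s. \<Sum>b\<in>Basis. \<integral>z. ?g b (s *\<^sub>R z) * (z \<bullet> b) \<partial>?\<sigma>) has_real_derivative A') (at r)"
    unfolding A'eq by (intro DERIV_sum DERIV_sphere_integral[OF r\<^sub>0 g _ r]) (auto intro!: continuous_intros)
  then have dA: "(A has_real_derivative A') (at r)"
    by (rule has_field_derivative_transform_within_open[of _ _ _ "{r\<^sub>0<..}"]) (use r A in auto)
  have div: "(\<integral>z. (\<Sum>b\<in>Basis. (\<Sum>c\<in>Basis. (r * (gradient (?g c) (r *\<^sub>R z) \<bullet> b)) *\<^sub>R c) \<bullet> b)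
       - (\<Sum>c\<in>Basis. (r * (gradient (?g c) (r *\<^sub>R z) \<bullet> z)) *\<^sub>R c) \<bullet> z \<partial>?\<sigma>)
     = (real DIM('a) - 1) * (\<integral>z. gradient u (r *\<^sub>R z) \<bullet> z \<partial>?\<sigma>)"
  proof (rule sphere_divergence[of "\<lambda>z. gradient u (r *\<^sub>R z)"
        "\<lambda>z h. \<Sum>c\<in>Basis. (r * (gradient (?g c) (r *\<^sub>R z) \<bullet> h)) *\<^sub>R c"])
    fix z :: 'a assume z: "norm z = 1"
    have "((\<lambda>z. ?g c (r *\<^sub>R z)) has_derivative (\<lambda>h. gradient (?g c) (r *\<^sub>R z) \<bullet> (r *\<^sub>R h))) (at z)"
      if "c \<in> Basis" for c
      by (rule has_derivative_compose[OF _ C1_on_has_derivative[OF g[OF that]]])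
         (use r r0 z in \<open>auto intro!: derivative_eq_intros simp: exterior_def\<close>)
    then show "((\<lambda>z. gradient u (r *\<^sub>R z)) has_derivative
        (\<lambda>h. \<Sum>c\<in>Basis. (r * (gradient (?g c) (r *\<^sub>R z) \<bullet> h)) *\<^sub>R c)) (at z)"
      unfolding gradu by (intro has_derivative_sum has_derivative_scaleR_left) simp
  next
    fix b :: 'a assume "b \<in> Basis"
    show "continuous_on (sphere 0 1) (\<lambda>z. \<Sum>c\<in>Basis. (r * (gradient (?g c) (r *\<^sub>R z) \<bullet> b)) *\<^sub>R c)"
      by (intro continuous_intros continuous_on_sphere_scale[OF C1_on_continuous_on_gradient[OF g]] r r\<^sub>0)
  qed
  have lap: "gradient (?g b) y \<bullet> b = partial_deriv b (?g b) y" if "b \<in> Basis" for b y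
    using that by (simp add: gradient_def inner_sum_left inner_Basis if_distrib cong: if_cong)
  have sel: "(\<Sum>c\<in>Basis. f c *\<^sub>R c) \<bullet> b = f b" if "b \<in> Basis" for f :: "'a \<Rightarrow> real" and b
    using that by (rule inner_sum_left_Basis)
  have "(\<lambda>z. (\<Sum>b\<in>Basis. (\<Sum>c\<in>Basis. (r * (gradient (?g c) (r *\<^sub>R z) \<bullet> b)) *\<^sub>R c) \<bullet> b)
       - (\<Sum>c\<in>Basis. (r * (gradient (?g c) (r *\<^sub>R z) \<bullet> z)) *\<^sub>R c) \<bullet> z)
     = (\<lambda>z. r * laplacian u (r *\<^sub>R z) - r * (\<Sum>b\<in>Basis. (gradient (?g b) (r *\<^sub>R z) \<bullet> z) * (z \<bullet> b)))" (is "?lhs = ?rhs")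
  proof
    fix z :: 'a
    have "(\<Sum>b\<in>Basis. (\<Sum>c\<in>Basis. (r * (gradient (?g c) (r *\<^sub>R z) \<bullet> b)) *\<^sub>R c) \<bullet> b) = r * laplacian u (r *\<^sub>R z)"
      by (auto simp: laplacian_def sum_distrib_left sel lap intro!: sum.cong)
    moreover have "(\<Sum>c\<in>Basis. (r * (gradient (?g c) (r *\<^sub>R z) \<bullet> z)) *\<^sub>R c) \<bullet> z
        = r * (\<Sum>b\<in>Basis. (gradient (?g b) (r *\<^sub>R z) \<bullet> z) * (z \<bullet> b))"
      by (simp add: inner_sum_left sum_distrib_left inner_commute[of z] mult.assoc)
    ultimately show "?lhs z = ?rhs z" by simp
  qed
  with div have "(\<integral>z. r * laplacian u (r *\<^sub>R z) - r * (\<Sum>b\<in>Basis. (gradient (?g b) (r *\<^sub>R z) \<bullet> z) * (z \<bullet> b)) \<partial>?\<sigma>)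
     = (real DIM('a) - 1) * A r"
    by (simp add: A_def)
  moreover have "(\<integral>z. r * laplacian u (r *\<^sub>R z) - r * (\<Sum>b\<in>Basis. (gradient (?g b) (r *\<^sub>R z) \<bullet> z) * (z \<bullet> b)) \<partial>?\<sigma>)
     = (\<integral>z. r * laplacian u (r *\<^sub>R z) \<partial>?\<sigma>) - (\<integral>z. r * (\<Sum>b\<in>Basis. (gradient (?g b) (r *\<^sub>R z) \<bullet> z) * (z \<bullet> b)) \<partial>?\<sigma>)"
    by (intro Bochner_Integration.integral_diff integrable_unit_sphere_measure continuous_intros clap cgg)
  ultimately have key: "r * (\<integral>z. laplacian u (r *\<^sub>R z) \<partial>?\<sigma>) = (real DIM('a) - 1) * A r + r * A'"
    by (simp add: A'_def)
  have "((\<lambda>s. s powr (real DIM('a) - 1) * A s) has_real_derivative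
      (real DIM('a) - 1) * r powr (real DIM('a) - 1 - 1) * A r + r powr (real DIM('a) - 1) * A') (at r)"
    using r0 by (auto intro!: derivative_eq_intros dA)
  also have "(real DIM('a) - 1) * r powr (real DIM('a) - 1 - 1) * A r + r powr (real DIM('a) - 1) * A'
     = r powr (real DIM('a) - 1 - 1) * ((real DIM('a) - 1) * A r + r * A')"
    using r0 powr_mult_base[of r "real DIM('a) - 1 - 1"] by (simp add: algebra_simps)
  also have "\<dots> = r powr (real DIM('a) - 1) * (\<integral>z. laplacian u (r *\<^sub>R z) \<partial>?\<sigma>)"
    unfolding key[symmetric] using r0 powr_mult_base[of r "real DIM('a) - 1 - 1"] by (simp add: algebra_simps)
  finally show ?thesis
    using DERIV_cdivide[of "\<lambda>s. s powr (real DIM('a) - 1) * A s" _ r UNIV ?\<omega>]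
    by (simp add: A_def mean_normal_deriv_def spherical_mean_def)
qed

section \<open>The system of radial inequalities\<close>

lemma power_growth_of_derivative:
  fixes w w' :: "real \<Rightarrow> real"
  assumes der: "\<And>r. r \<ge> R \<Longrightarrow> (w has_real_derivative w' r) (at r)"
    and low: "\<And>r. r \<ge> R \<Longrightarrow> c * r powr (b - 1) \<le> w' r"
    and pos: "c > 0" "b > 0" "R > 0"
  obtains c' R' where "c' > 0" "R' \<ge> R" "\<And>r. r \<ge> R' \<Longrightarrow> c' * r powr b \<le> w r"
proof -
  define g where "g r = w r - c / b * r powr b" for r
  have mono: "g R \<le> g r" if "r \<ge> R" for r
  proof (rule DERIV_nonneg_imp_nondecreasing[OF that])
    fix x assume x: "R \<le> x"
    then have "(g has_real_derivative w' x - c * x powr (b - 1)) (at x)"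
      unfolding g_def using pos by (auto intro!: derivative_eq_intros der)
    with low[OF x] show "\<exists>y. (g has_real_derivative y) (at x) \<and> 0 \<le> y"
      by auto
  qed
  have "filterlim (\<lambda>r. r powr b) at_top at_top"
    using pos by (intro real_powr_at_top) auto
  then have "eventually (\<lambda>r. r powr b \<ge> - g R * (2 * b / c)) at_top"
    by (auto simp: filterlim_at_top)
  then obtain R1 where R1: "\<And>r. r \<ge> R1 \<Longrightarrow> r powr b \<ge> - g R * (2 * b / c)"
    by (auto simp: eventually_at_top_linorder)
  have "c / (2 * b) * r powr b \<le> w r" if r: "r \<ge> max R R1" for r
  proof -
    have "- g R \<le> c / (2 * b) * r powr b"
      using R1[of r] r pos by (simp add: field_simps)
    moreover have "w r = g r + c / (2 * b) * r powr b + c / (2 * b) * r powr b"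
      by (simp add: g_def)
    ultimately show ?thesis using mono[of r] r by simp
  qed
  then show ?thesis
    using pos by (intro that[of "c / (2 * b)" "max R R1"]) auto
qed

text \<open>Here \<open>v\<close> is the mean of the first component and \<open>w\<^sub>1, w\<^sub>2\<close> are the inward fluxes.  A lower bound
\<open>r powr \<beta>\<close> for \<open>w\<^sub>1\<close> gives one for \<open>w\<^sub>2\<close>, which gives a better one for \<open>w\<^sub>1\<close>: the exponent
\<open>\<beta>\<close> becomes \<open>\<delta> + p * q * \<beta>\<close>, and \<open>\<delta> > 0\<close> is exactly the hypothesis on \<open>q\<close>.  Hence \<open>\<beta>\<close> can be
made as large as desired, and a flux growing at least like the area of the sphere forces \<open>v\<close> below
zero.\<close>

lemma radial_system_impossible:
  fixes N p q r\<^sub>0 :: real and v w\<^sub>1 w\<^sub>2 w\<^sub>1' w\<^sub>2' :: "real \<Rightarrow> real"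
  assumes N: "N > 1" and q: "q \<ge> 1" and pq: "p \<ge> q" and sub: "q < (N + p) / ((N - 1) * p)" and r\<^sub>0: "r\<^sub>0 > 0"
    and dv: "\<And>r. r > r\<^sub>0 \<Longrightarrow> (v has_real_derivative - (r powr (1 - N) * w\<^sub>1 r)) (at r)"
    and dw1: "\<And>r. r > r\<^sub>0 \<Longrightarrow> (w\<^sub>1 has_real_derivative w\<^sub>1' r) (at r)"
    and dw2: "\<And>r. r > r\<^sub>0 \<Longrightarrow> (w\<^sub>2 has_real_derivative w\<^sub>2' r) (at r)"
    and low1: "\<And>r. r > r\<^sub>0 \<Longrightarrow> r powr (N - 1) * \<bar>r powr (1 - N) * w\<^sub>2 r\<bar> powr p \<le> w\<^sub>1' r"
    and low2: "\<And>r. r > r\<^sub>0 \<Longrightarrow> r powr (N - 1) * \<bar>r powr (1 - N) * w\<^sub>1 r\<bar> powr q \<le> w\<^sub>2' r"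
    and pos: "\<And>r. r > r\<^sub>0 \<Longrightarrow> v r > 0" and lim: "(v \<longlongrightarrow> 0) at_top"
  shows False
proof -
  define \<delta> where "\<delta> = N + p - p * (N - 1) * q"
  have p: "p \<ge> 1" using pq q by simp
  have \<delta>: "\<delta> > 0"
    using sub N p by (simp add: pos_less_divide_eq \<delta>_def mult_ac)
  \<comment> \<open>This makes the lower bound for \<open>w\<^sub>2'\<close> non-integrable at infinity already when \<open>w\<^sub>1\<close> is merely
    bounded below by a positive constant; hence \<open>w\<^sub>2\<close> becomes positive whatever its initial sign.\<close>
  have crit: "(N - 1) * q < N"
  proof (rule ccontr)
    assume "\<not> (N - 1) * q < N"
    then have h: "N \<le> (N - 1) * q" by simp
    have "p * (N - 1) \<le> p * ((N - 1) * q - 1)"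
      using h p by (intro mult_left_mono) auto
    moreover have "q * (N - 1) \<le> p * (N - 1)"
      using pq N by (intro mult_right_mono) auto
    ultimately show False using h \<delta> by (simp add: \<delta>_def algebra_simps)
  qed
  define G where "G \<beta> \<longleftrightarrow> (\<exists>c R. c > 0 \<and> R > r\<^sub>0 \<and> (\<forall>r\<ge>R. c * r powr \<beta> \<le> w\<^sub>1 r))" for \<beta>
  \<comment> \<open>Otherwise \<open>v\<close> would be nondecreasing and positive, so it could not tend to zero.\<close>
  have "\<exists>R>r\<^sub>0. w\<^sub>1 R > 0"
  proof (rule ccontr)
    assume "\<not> ?thesis"
    then have neg: "\<And>r. r > r\<^sub>0 \<Longrightarrow> w\<^sub>1 r \<le> 0" by force
    have "v (r\<^sub>0 + 1) \<le> v r" if "r \<ge> r\<^sub>0 + 1" for r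
    proof (rule DERIV_nonneg_imp_nondecreasing[OF that])
      fix x assume "r\<^sub>0 + 1 \<le> x"
      then have "x > r\<^sub>0" by simp
      then show "\<exists>y. (v has_real_derivative y) (at x) \<and> 0 \<le> y"
        using dv[of x] neg[of x] by (intro exI[of _ "- (x powr (1 - N) * w\<^sub>1 x)"]) (auto simp: mult_le_0_iff)
    qed
    then have "eventually (\<lambda>r. v (r\<^sub>0 + 1) \<le> v r) at_top"
      by (auto simp: eventually_at_top_linorder)
    then have "v (r\<^sub>0 + 1) \<le> 0"
      by (intro tendsto_lowerbound[OF lim]) auto
    with pos[of "r\<^sub>0 + 1"] show False by simp
  qed
  then obtain R where R: "R > r\<^sub>0" "w\<^sub>1 R > 0" by blast
  have w1mono: "w\<^sub>1 R \<le> w\<^sub>1 r" if "r \<ge> R" for r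
  proof (rule DERIV_nonneg_imp_nondecreasing[OF that])
    fix x assume "R \<le> x"
    with R have x: "x > r\<^sub>0" by simp
    have "0 \<le> x powr (N - 1) * \<bar>x powr (1 - N) * w\<^sub>2 x\<bar> powr p" by simp
    with low1[OF x] have "0 \<le> w\<^sub>1' x" by linarith
    with dw1[OF x] show "\<exists>y. (w\<^sub>1 has_real_derivative y) (at x) \<and> 0 \<le> y" by blast
  qed
  have G0: "G 0"
    unfolding G_def using R w1mono r\<^sub>0 by (intro exI[of _ "w\<^sub>1 R"] exI[of _ R]) auto
  have step: "G (\<beta> + \<delta>)" if "G \<beta>" "\<beta> \<ge> 0" for \<beta>
  proof -
    from that obtain c R where c: "c > 0" "R > r\<^sub>0" and w1: "\<And>r. r \<ge> R \<Longrightarrow> c * r powr \<beta> \<le> w\<^sub>1 r"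
      by (auto simp: G_def)
    define a where "a = N - (N - 1) * q + q * \<beta>"
    have a: "a > 0" using crit that q by (simp add: a_def add_pos_nonneg)
    obtain c2 R2 where c2: "c2 > 0" "R2 \<ge> R" and w2: "\<And>r. r \<ge> R2 \<Longrightarrow> c2 * r powr a \<le> w\<^sub>2 r"
    proof (rule power_growth_of_derivative[of R w\<^sub>2 w\<^sub>2' "c powr q" a])
      fix r assume r: "r \<ge> R"
      with c r\<^sub>0 have r': "r > r\<^sub>0" "r > 0" by auto
      show "(w\<^sub>2 has_real_derivative w\<^sub>2' r) (at r)" by (rule dw2[OF r'(1)])
      have e: "a - 1 = (N - 1) + ((1 - N) * q + \<beta> * q)" by (simp add: a_def algebra_simps)
      have "c powr q * r powr (a - 1) = r powr (N - 1) * (r powr (1 - N) * (c * r powr \<beta>)) powr q"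
        using c r' unfolding e by (simp add: powr_mult powr_add powr_powr mult_ac)
      also have "\<dots> \<le> r powr (N - 1) * \<bar>r powr (1 - N) * w\<^sub>1 r\<bar> powr q"
        using c r' q w1[OF r] by (intro mult_left_mono powr_mono2 order_trans[OF _ abs_ge_self]) auto
      also have "\<dots> \<le> w\<^sub>2' r" by (rule low2[OF r'(1)])
      finally show "c powr q * r powr (a - 1) \<le> w\<^sub>2' r" .
    qed (use c a r\<^sub>0 in auto)
    define b where "b = \<delta> + p * q * \<beta>"
    have b: "b > 0" using \<delta> p q that by (simp add: b_def add_pos_nonneg)
    obtain c3 R3 where c3: "c3 > 0" "R3 \<ge> R2" and w3: "\<And>r. r \<ge> R3 \<Longrightarrow> c3 * r powr b \<le> w\<^sub>1 r"
    proof (rule power_growth_of_derivative[of R2 w\<^sub>1 w\<^sub>1' "c2 powr p" b])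
      fix r assume r: "r \<ge> R2"
      with c c2 r\<^sub>0 have r': "r > r\<^sub>0" "r > 0" by auto
      show "(w\<^sub>1 has_real_derivative w\<^sub>1' r) (at r)" by (rule dw1[OF r'(1)])
      have e: "b - 1 = (N - 1) + ((1 - N) * p + a * p)" by (simp add: a_def b_def \<delta>_def algebra_simps)
      have "c2 powr p * r powr (b - 1) = r powr (N - 1) * (r powr (1 - N) * (c2 * r powr a)) powr p"
        using c2 r' unfolding e by (simp add: powr_mult powr_add powr_powr mult_ac)
      also have "\<dots> \<le> r powr (N - 1) * \<bar>r powr (1 - N) * w\<^sub>2 r\<bar> powr p"
        using c2 r' p w2[OF r] by (intro mult_left_mono powr_mono2 order_trans[OF _ abs_ge_self]) auto
      also have "\<dots> \<le> w\<^sub>1' r" by (rule low1[OF r'(1)])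
      finally show "c2 powr p * r powr (b - 1) \<le> w\<^sub>1' r" .
    qed (use c c2 b r\<^sub>0 in auto)
    \<comment> \<open>The gain \<open>\<delta>\<close> alone suffices for the iteration and keeps the exponents explicit.\<close>
    have "1 * \<beta> \<le> p * q * \<beta>"
      using p q that mult_mono[of 1 p 1 q] by (intro mult_right_mono) auto
    then have bb: "\<beta> + \<delta> \<le> b" by (simp add: b_def)
    show ?thesis unfolding G_def
    proof (rule exI[of _ c3], rule exI[of _ "max R3 1"], intro conjI allI impI)
      fix r assume r: "max R3 1 \<le> r"
      then have "c3 * r powr (\<beta> + \<delta>) \<le> c3 * r powr b"
        using bb c3 by (intro mult_left_mono powr_mono) auto
      also have "\<dots> \<le> w\<^sub>1 r" using r by (intro w3) auto
      finally show "c3 * r powr (\<beta> + \<delta>) \<le> w\<^sub>1 r" .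
    qed (use c c2 c3 in auto)
  qed
  have Gk: "G (real k * \<delta>)" for k
  proof (induction k)
    case 0 then show ?case using G0 by simp
  next
    case (Suc k)
    then show ?case using step[of "real k * \<delta>"] \<delta> by (simp add: algebra_simps)
  qed
  obtain k :: nat where k: "real k * \<delta> > N - 1"
    using reals_Archimedean3[OF \<delta>] by blast
  from Gk[of k] obtain c R where c: "c > 0" "R > r\<^sub>0" and w1: "\<And>r. r \<ge> R \<Longrightarrow> c * r powr (real k * \<delta>) \<le> w\<^sub>1 r"
    by (auto simp: G_def)
  define S where "S = max R 1"
  have S: "S \<ge> R" "S \<ge> 1" "S > r\<^sub>0" using c by (auto simp: S_def)
  have upper: "v r + c * r \<le> v S + c * S" if "r \<ge> S" for r
  proof (rule DERIV_nonpos_imp_nonincreasing[OF that])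
    fix x assume x: "S \<le> x"
    then have x': "x > r\<^sub>0" "x \<ge> 1" "x \<ge> R" using S by auto
    have "1 \<le> x powr (1 - N + real k * \<delta>)"
      using x' k by (intro ge_one_powr_ge_zero) auto
    then have "c * 1 \<le> c * x powr (1 - N + real k * \<delta>)"
      using c by (intro mult_left_mono) auto
    also have "\<dots> = x powr (1 - N) * (c * x powr (real k * \<delta>))"
      by (simp add: powr_add)
    also have "\<dots> \<le> x powr (1 - N) * w\<^sub>1 x"
      using w1[OF x'(3)] by (intro mult_left_mono) auto
    finally have "- (x powr (1 - N) * w\<^sub>1 x) + c \<le> 0" by simp
    moreover have "((\<lambda>r. v r + c * r) has_real_derivative - (x powr (1 - N) * w\<^sub>1 x) + c) (at x)"
      by (auto intro!: derivative_eq_intros dv[OF x'(1)])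
    ultimately show "\<exists>y. ((\<lambda>r. v r + c * r) has_real_derivative y) (at x) \<and> y \<le> 0" by blast
  qed
  \<comment> \<open>Far enough out for the linear decrease of \<open>v\<close> with slope \<open>-c\<close> from \<open>S\<close> on to reach zero.\<close>
  define r where "r = S + v S / c"
  have "r \<ge> S" using pos[OF S(3)] c by (simp add: r_def)
  moreover have "c * r = c * S + v S" using c by (simp add: r_def field_simps)
  ultimately have "v r \<le> 0" using upper[of r] by simp
  moreover have "v r > 0" using \<open>r \<ge> S\<close> S by (intro pos) auto
  ultimately show False by simp
qed

section \<open>Averaging a supersolution\<close>

lemma powr_above_tangent:
  fixes m t p :: real
  assumes "p \<ge> 1" "m > 0" "t \<ge> 0"
  shows "m powr p + p * m powr (p - 1) * (t - m) \<le> t powr p"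
proof (cases "t = 0")
  case True
  have "m powr p = m * m powr (p - 1)"
    using powr_mult_base[of m "p - 1"] assms by simp
  then have "m powr p + p * m powr (p - 1) * (t - m) = (1 - p) * m powr p"
    by (simp add: True algebra_simps)
  with assms True show ?thesis by (simp add: mult_le_0_iff)
next
  case False
  have "t powr p - m powr p \<ge> p * m powr (p - 1) * (t - m)"
  proof (rule convex_on_imp_above_tangent[where A="{0<..}"])
    show "convex_on {0<..} (\<lambda>x. x powr p)" using assms by (intro powr_convex)
    show "((\<lambda>x. x powr p) has_real_derivative p * m powr (p - 1)) (at m within {0<..})"
      using assms by (auto intro!: derivative_eq_intros)
  qed (use assms False in \<open>auto simp: interior_open\<close>)
  then show ?thesis by simp
qed

text \<open>Integrating the tangent line of the power function at the mean of \<open>F\<close> gives Jensen's inequality.\<close>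

lemma sphere_mean_powr_le:
  fixes f F :: "'a::euclidean_space \<Rightarrow> real"
  assumes p: "p \<ge> 1" and f: "continuous_on (sphere 0 1) f" and F: "continuous_on (sphere 0 1) F"
    and le: "\<And>x. norm x = 1 \<Longrightarrow> \<bar>f x\<bar> \<le> F x"
  shows "\<bar>(\<integral>x. f x \<partial>unit_sphere_measure) / measure unit_sphere_measure (sphere (0::'a) 1)\<bar> powr p
    \<le> (\<integral>x. F x powr p \<partial>unit_sphere_measure) / measure unit_sphere_measure (sphere (0::'a) 1)"
proof -
  let ?\<sigma> = "unit_sphere_measure :: 'a measure"
  define \<omega> where "\<omega> = measure ?\<sigma> (sphere 0 1)"
  have \<omega>: "\<omega> > 0" by (simp add: \<omega>_def measure_unit_sphere)
  have F0: "0 \<le> F x" if "norm x = 1" for x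
    using le[OF that] abs_ge_zero order_trans by blast
  have cp: "continuous_on (sphere 0 1) (\<lambda>x. F x powr p)"
    using p F0 by (intro continuous_on_powr' F continuous_intros) auto
  have ip: "integrable ?\<sigma> (\<lambda>x. F x powr p)" by (rule integrable_unit_sphere_measure[OF cp])
  have iF: "integrable ?\<sigma> F" by (rule integrable_unit_sphere_measure[OF F])
  define m where "m = (\<integral>x. F x \<partial>?\<sigma>) / \<omega>"
  have "\<bar>\<integral>x. f x \<partial>?\<sigma>\<bar> \<le> (\<integral>x. \<bar>f x\<bar> \<partial>?\<sigma>)"
    using integral_abs_bound by blast
  also have "\<dots> \<le> (\<integral>x. F x \<partial>?\<sigma>)"
    using le by (intro Bochner_Integration.integral_mono integrable_unit_sphere_measure continuous_intros f F)
      (auto simp: space_unit_sphere_measure)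
  finally have m: "\<bar>(\<integral>x. f x \<partial>?\<sigma>) / \<omega>\<bar> \<le> m"
    using \<omega> by (simp add: m_def abs_divide divide_right_mono)
  have nn: "0 \<le> (\<integral>x. F x powr p \<partial>?\<sigma>) / \<omega>"
    using \<omega> by (intro divide_nonneg_pos Bochner_Integration.integral_nonneg) auto
  have "m powr p \<le> (\<integral>x. F x powr p \<partial>?\<sigma>) / \<omega>"
  proof (cases "m > 0")
    case False
    with m have "m = 0" using abs_ge_zero[of "(\<integral>x. f x \<partial>?\<sigma>) / \<omega>"] by linarith
    then show ?thesis using nn by simp
  next
    case True
    have c: "measure ?\<sigma> (space ?\<sigma>) = \<omega>"
      by (simp add: \<omega>_def space_unit_sphere_measure)
    have ic: "integrable ?\<sigma> (\<lambda>x. k)" for k :: real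
      by (rule integrable_unit_sphere_measure) simp
    have "(\<integral>x. m powr p + p * m powr (p - 1) * (F x - m) \<partial>?\<sigma>)
        = \<omega> * m powr p + p * m powr (p - 1) * ((\<integral>x. F x \<partial>?\<sigma>) - \<omega> * m)"
      using iF ic by (simp add: c)
    also have "\<dots> = \<omega> * m powr p" using \<omega> by (simp add: m_def)
    finally have "\<omega> * m powr p = (\<integral>x. m powr p + p * m powr (p - 1) * (F x - m) \<partial>?\<sigma>)" ..
    also have "\<dots> \<le> (\<integral>x. F x powr p \<partial>?\<sigma>)"
      using iF ic ip powr_above_tangent[OF p True] F0
      by (intro Bochner_Integration.integral_mono) (auto simp: space_unit_sphere_measure)
    finally show ?thesis using \<omega> by (simp add: field_simps)
  qed
  moreover have "\<bar>(\<integral>x. f x \<partial>?\<sigma>) / \<omega>\<bar> powr p \<le> m powr p"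
    using m p by (intro powr_mono2) auto
  ultimately show ?thesis by (simp add: \<omega>_def)
qed

lemma spherical_mean_mono:
  fixes f g :: "'a::euclidean_space \<Rightarrow> real"
  assumes "continuous_on (sphere 0 1) (\<lambda>x. f (r *\<^sub>R x))" "continuous_on (sphere 0 1) (\<lambda>x. g (r *\<^sub>R x))"
    and "\<And>x. norm x = 1 \<Longrightarrow> f (r *\<^sub>R x) \<le> g (r *\<^sub>R x)"
  shows "spherical_mean f r \<le> spherical_mean g r"
  unfolding spherical_mean_def using assms
  by (intro divide_right_mono Bochner_Integration.integral_mono integrable_unit_sphere_measure)
     (auto simp: space_unit_sphere_measure)

lemma spherical_mean_pos:
  fixes f :: "'a::euclidean_space \<Rightarrow> real"
  assumes c: "continuous_on (sphere 0 1) (\<lambda>x. f (r *\<^sub>R x))" and pos: "\<And>x. norm x = 1 \<Longrightarrow> f (r *\<^sub>R x) > 0"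
  shows "spherical_mean f r > 0"
proof -
  obtain b :: 'a where "b \<in> Basis" using nonempty_Basis by blast
  then have "sphere (0::'a) 1 \<noteq> {}" by auto
  then obtain y where y: "norm y = 1" "\<And>x. norm x = 1 \<Longrightarrow> f (r *\<^sub>R y) \<le> f (r *\<^sub>R x)"
    using continuous_attains_inf[OF compact_sphere _ c] by auto
  have "spherical_mean (\<lambda>_::'a. f (r *\<^sub>R y)) r \<le> spherical_mean f r"
    by (rule spherical_mean_mono) (use y c in auto)
  moreover have "spherical_mean (\<lambda>_::'a. f (r *\<^sub>R y)) r = f (r *\<^sub>R y)"
    by (simp add: spherical_mean_def space_unit_sphere_measure measure_unit_sphere unit_ball_vol_pos less_imp_neq[symmetric])
  ultimately show ?thesis using pos[OF y(1)] by simp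
qed

text \<open>Averaging keeps the supersolution inequality: the mean of the normal derivative is controlled by the
mean of the norm of the gradient, and the power passes inside the mean.\<close>

lemma mean_normal_deriv_powr_le:
  fixes u\<^sub>1 u\<^sub>2 :: "'a::euclidean_space \<Rightarrow> real"
  assumes r\<^sub>0: "r\<^sub>0 > 0" and r: "r > r\<^sub>0" and s: "s \<ge> 1"
    and u: "C2_on (exterior r\<^sub>0) u\<^sub>1" and v: "C1_on (exterior r\<^sub>0) u\<^sub>2"
    and super: "\<And>x. x \<in> exterior r\<^sub>0 \<Longrightarrow> norm (gradient u\<^sub>2 x) powr s \<le> - laplacian u\<^sub>1 x"
  shows "\<bar>mean_normal_deriv u\<^sub>2 r\<bar> powr s \<le> - spherical_mean (laplacian u\<^sub>1) r"
proof -
  have cg: "continuous_on (sphere 0 1) (\<lambda>x. gradient u\<^sub>2 (r *\<^sub>R x))"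
    by (rule continuous_on_sphere_scale[OF C1_on_continuous_on_gradient[OF v] r r\<^sub>0])
  have cl: "continuous_on (sphere 0 1) (\<lambda>x. laplacian u\<^sub>1 (r *\<^sub>R x))"
    unfolding laplacian_def using u r r\<^sub>0
    by (intro continuous_intros continuous_on_sphere_scale) (auto simp: C2_on_def C1_on_def)
  have "\<bar>mean_normal_deriv u\<^sub>2 r\<bar> powr s \<le> spherical_mean (\<lambda>x. norm (gradient u\<^sub>2 x) powr s) r"
    unfolding mean_normal_deriv_def spherical_mean_def
  proof (rule sphere_mean_powr_le[OF s])
    fix x :: 'a assume "norm x = 1"
    then show "\<bar>gradient u\<^sub>2 (r *\<^sub>R x) \<bullet> x\<bar> \<le> norm (gradient u\<^sub>2 (r *\<^sub>R x))"
      using Cauchy_Schwarz_ineq2[of "gradient u\<^sub>2 (r *\<^sub>R x)" x] by simp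
  qed (auto intro!: continuous_intros cg)
  also have "\<dots> \<le> spherical_mean (\<lambda>x. - laplacian u\<^sub>1 x) r"
  proof (rule spherical_mean_mono)
    show "continuous_on (sphere 0 1) (\<lambda>x. norm (gradient u\<^sub>2 (r *\<^sub>R x)) powr s)"
      using s by (intro continuous_on_powr' continuous_intros cg) auto
    show "continuous_on (sphere 0 1) (\<lambda>x. - laplacian u\<^sub>1 (r *\<^sub>R x))"
      by (intro continuous_intros cl)
  qed (use super r r\<^sub>0 in \<open>auto simp: exterior_def\<close>)
  also have "\<dots> = - spherical_mean (laplacian u\<^sub>1) r"
    by (simp add: spherical_mean_def)
  finally show ?thesis .
qed

lemma no_positive_supersolution:
  fixes p q r\<^sub>0 :: real and u\<^sub>1 u\<^sub>2 :: "'a::euclidean_space \<Rightarrow> real"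
  assumes N: "DIM('a) \<ge> 2" and pq: "p \<ge> q" and q: "q \<ge> 1"
    and sub: "q < (real DIM('a) + p) / ((real DIM('a) - 1) * p)"
    and r\<^sub>0: "r\<^sub>0 > 0" and super: "supersolution (exterior r\<^sub>0) p q u\<^sub>1 u\<^sub>2"
    and pos: "\<And>x. x \<in> exterior r\<^sub>0 \<Longrightarrow> u\<^sub>1 x > 0"
    and lim: "(spherical_mean u\<^sub>1 \<longlongrightarrow> 0) at_top"
  shows False
proof -
  define N where "N = real DIM('a)"
  have N1: "N > 1" using N by (simp add: N_def)
  have u: "C2_on (exterior r\<^sub>0) u\<^sub>1" "C2_on (exterior r\<^sub>0) u\<^sub>2"
    and u1: "C1_on (exterior r\<^sub>0) u\<^sub>1" "C1_on (exterior r\<^sub>0) u\<^sub>2"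
    and s: "\<And>x. x \<in> exterior r\<^sub>0 \<Longrightarrow> norm (gradient u\<^sub>2 x) powr p \<le> - laplacian u\<^sub>1 x"
      "\<And>x. x \<in> exterior r\<^sub>0 \<Longrightarrow> norm (gradient u\<^sub>1 x) powr q \<le> - laplacian u\<^sub>2 x"
    using super by (auto simp: supersolution_def C2_on_def)
  \<comment> \<open>The inward fluxes, up to the area of the unit sphere; both are nondecreasing.\<close>
  define w where "w u r = - (r powr (N - 1) * mean_normal_deriv u r)" for u :: "'a \<Rightarrow> real" and r
  define w' where "w' u r = r powr (N - 1) * - spherical_mean (laplacian u) r" for u :: "'a \<Rightarrow> real" and r
  have flux: "mean_normal_deriv v r = - (r powr (1 - N) * w v r)" if "r > r\<^sub>0" for v :: "'a \<Rightarrow> real" and r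
  proof -
    have "r powr (1 - N) * r powr (N - 1) = 1"
      using that r\<^sub>0 by (simp add: powr_add[symmetric])
    then show ?thesis by (simp add: w_def mult.assoc[symmetric])
  qed
  have dw: "(w v has_real_derivative w' v r) (at r)" if "C2_on (exterior r\<^sub>0) v" "r > r\<^sub>0" for v r
    using DERIV_minus[OF DERIV_flux[OF r\<^sub>0 that]] by (simp add: w_def[abs_def] w'_def N_def)
  have low: "r powr (N - 1) * \<bar>r powr (1 - N) * w v r\<bar> powr t \<le> w' u r"
    if "r > r\<^sub>0" "t \<ge> 1" "C2_on (exterior r\<^sub>0) u" "C1_on (exterior r\<^sub>0) v"
      "\<And>x. x \<in> exterior r\<^sub>0 \<Longrightarrow> norm (gradient v x) powr t \<le> - laplacian u x" for u v r t
    using mean_normal_deriv_powr_le[OF r\<^sub>0 that] unfolding w'_def flux[OF that(1)] by (intro mult_left_mono) auto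
  show False
  proof (rule radial_system_impossible[of N q p r\<^sub>0 "spherical_mean u\<^sub>1" "w u\<^sub>1" "w' u\<^sub>1" "w u\<^sub>2" "w' u\<^sub>2"])
    show "q < (N + p) / ((N - 1) * p)" using sub by (simp add: N_def)
    fix r assume r: "r > r\<^sub>0"
    show "(spherical_mean u\<^sub>1 has_real_derivative - (r powr (1 - N) * w u\<^sub>1 r)) (at r)"
      using DERIV_spherical_mean[OF r\<^sub>0 u1(1) r] unfolding flux[OF r] .
    show "r powr (N - 1) * \<bar>r powr (1 - N) * w u\<^sub>2 r\<bar> powr p \<le> w' u\<^sub>1 r"
      using pq q by (intro low r u u1 s) auto
    show "r powr (N - 1) * \<bar>r powr (1 - N) * w u\<^sub>1 r\<bar> powr q \<le> w' u\<^sub>2 r"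
      using q by (intro low r u u1 s) auto
    show "0 < spherical_mean u\<^sub>1 r"
      using r r\<^sub>0 by (intro spherical_mean_pos continuous_on_sphere_scale[OF C1_on_continuous_on[OF u1(1)]] pos)
        (auto simp: exterior_def)
  qed (use N1 q pq r\<^sub>0 lim dw u in auto)
qed

theorem theorem6p7:
  fixes p q :: real
  assumes "CARD('n::finite) \<ge> 3"
    and "p \<ge> q" and "q \<ge> 1" and "p * q > 1"
    and "q < (real CARD('n) + p) / ((real CARD('n) - 1) * p)"
  shows "\<not> (\<exists>(r\<^sub>0::real) (u\<^sub>1 :: real ^ 'n \<Rightarrow> real) (u\<^sub>2 :: real ^ 'n \<Rightarrow> real).
    r\<^sub>0 > 0 \<and>
    supersolution (UNIV - closure (ball 0 r\<^sub>0)) p q u\<^sub>1 u\<^sub>2 \<and>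
    (\<forall>x \<in> UNIV - closure (ball 0 r\<^sub>0). u\<^sub>1 x > 0 \<and> u\<^sub>2 x > 0) \<and>
    (spherical_mean u\<^sub>1 \<longlongrightarrow> 0) at_top)"
proof (clarify)
  fix r\<^sub>0 :: real and u\<^sub>1 u\<^sub>2 :: "real ^ 'n \<Rightarrow> real"
  assume r\<^sub>0: "r\<^sub>0 > 0"
    and super: "supersolution (UNIV - closure (ball 0 r\<^sub>0)) p q u\<^sub>1 u\<^sub>2"
    and pos: "\<forall>x \<in> UNIV - closure (ball 0 r\<^sub>0). u\<^sub>1 x > 0 \<and> u\<^sub>2 x > 0"
    and lim: "(spherical_mean u\<^sub>1 \<longlongrightarrow> 0) at_top"
  have ext: "UNIV - closure (ball 0 r\<^sub>0) = (exterior r\<^sub>0 :: (real ^ 'n) set)"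
    using r\<^sub>0 by (auto simp: exterior_def)
  show False
    using no_positive_supersolution[of q p r\<^sub>0 u\<^sub>1 u\<^sub>2] assms r\<^sub>0 super pos lim
    unfolding ext by simp
qed

end
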